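(* Let $d\ge2$ and let $\mathbf{K}$ be a compact set of Borel probability measures on $\mathrm{SL}(d,\mathbb{R})$. Assume that (log-moment condition) for every $\mu\in\mathbf{K}$ one has $\int_{\mathrm{SL}(d,\mathbb{R})}\log\|A\|\,d\mu(A)<\infty$; (measures condition) for every $\mu\in\mathbf{K}$ there are no Borel probability measures $\nu_1,\nu_2$ on $\mathbb{RP}^{d-1}$ such that $(f_A)_*\nu_1=\nu_2$ for $\mu$-almost every $A\in\mathrm{SL}(d,\mathbb{R})$. Moreover, assume that for some $m$ with $1\le m\le d-1$, for every $j=1,\dots,m$ there are no measure $\mu\in\mathbf{K}$ and nonempty finite unions $U,U'$ of $j$-dimensional subspaces of $\mathbb{R}^d$ such that $A(U)=U'$ for $\mu$-a.e. $A\in\mathrm{SL}(d,\mathbb{R})$. Then for any $\varepsilon>0$ there is a number of iterations $k_m(\varepsilon)$ such that for all $k\ge k_m(\varepsilon)$, all $x_0\in\mathbb{RP}^{d-1}$, all $L\in\mathrm{Gr}(m,d)$ and all $\mu_1,\dots,\mu_k\in\mathbf{K}$ $$\mathbb{P}_{\mu_1,\dots,\mu_k}\bigl((f_k\circ\dots\circ f_1)(x_0)\in[L]\bigr)<\varepsilon .$$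
   Context: Compactness of $\mathbf{K}$ is with respect to the topology of weak-$*$ (weak) convergence of probability measures. $\|A\|$ is the operator norm of $A$ for the Euclidean norm on $\mathbb{R}^d$. For $A\in\mathrm{SL}(d,\mathbb{R})$, $f_A:\mathbb{RP}^{d-1}\to\mathbb{RP}^{d-1}$ is the induced projective transformation. $\mathrm{Gr}(m,d)$ is the set of $m$-dimensional subspaces of $\mathbb{R}^d$; for $L\in\mathrm{Gr}(m,d)$, $[L]\subset\mathbb{RP}^{d-1}$ is the corresponding $(m-1)$-dimensional projective subspace. In the probability, $f_i=f_{A_i}$ with $A_i$, $i=1,\dots,k$, independent and distributed with respect to $\mu_i$. *)

theory Defs
  imports "HOL-Probability.Probability"
begin

definition SL :: "(real^'n^'n) set" where
  "SL = {A. det A = 1}"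

definition Gr :: "nat \<Rightarrow> (real^'n) set set" where
  "Gr m = {L. subspace L \<and> dim L = m}"

text \<open>A point of the projective space is a line through the origin, as a set of vectors.\<close>

definition proj_space :: "(real^'n) set set" where
  "proj_space = {span {v} |v. v \<noteq> 0}"

definition proj_subspace :: "(real^'n) set \<Rightarrow> (real^'n) set set" where
  "proj_subspace L = {l \<in> proj_space. l \<subseteq> L}"

text \<open>The quotient topology, i.e. the finest one making \<open>v \<mapsto> span {v}\<close> continuous on the
  nonzero vectors; see \<open>quotient_map_proj_topology\<close>.\<close>

definition proj_topology :: "(real^'n) set topology" where
  "proj_topology =
     topology (\<lambda>U. U \<subseteq> proj_space \<and> open {v. v \<noteq> 0 \<and> span {v} \<in> U})"

lemma openin_proj_topology:
  "openin proj_topology U \<longleftrightarrow>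
     U \<subseteq> proj_space \<and> open {v :: real^'n. v \<noteq> 0 \<and> span {v} \<in> U}"
proof -
  have "istopology (\<lambda>U. U \<subseteq> proj_space \<and> open {v :: real^'n. v \<noteq> 0 \<and> span {v} \<in> U})"
    unfolding istopology_def
  proof (intro conjI allI impI)
    fix S T :: "(real^'n) set set"
    assume S: "S \<subseteq> proj_space \<and> open {v. v \<noteq> 0 \<and> span {v} \<in> S}"
      and T: "T \<subseteq> proj_space \<and> open {v. v \<noteq> 0 \<and> span {v} \<in> T}"
    show "S \<inter> T \<subseteq> proj_space" using S by blast
    have "{v. v \<noteq> 0 \<and> span {v} \<in> S \<inter> T} =
        {v. v \<noteq> 0 \<and> span {v} \<in> S} \<inter> {v. v \<noteq> 0 \<and> span {v} \<in> T}" by blast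
    then show "open {v. v \<noteq> 0 \<and> span {v} \<in> S \<inter> T}" using S T by auto
  next
    fix \<K> :: "(real^'n) set set set"
    assume K: "\<forall>S\<in>\<K>. S \<subseteq> proj_space \<and> open {v. v \<noteq> 0 \<and> span {v} \<in> S}"
    show "\<Union>\<K> \<subseteq> proj_space" using K by blast
    have "{v. v \<noteq> 0 \<and> span {v} \<in> \<Union>\<K>} = (\<Union>S\<in>\<K>. {v. v \<noteq> 0 \<and> span {v} \<in> S})" by blast
    then show "open {v. v \<noteq> 0 \<and> span {v} \<in> \<Union>\<K>}" using K by auto
  qed
  then show ?thesis by (simp add: proj_topology_def)
qed

lemma topspace_proj_topology: "topspace proj_topology = (proj_space :: (real^'n) set set)"
proof -
  have "{v :: real^'n. v \<noteq> 0 \<and> span {v} \<in> proj_space} = - {0}"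
    by (auto simp: proj_space_def)
  then have "openin proj_topology (proj_space :: (real^'n) set set)"
    by (simp add: openin_proj_topology open_Compl)
  then show ?thesis
    by (meson openin_proj_topology openin_subset openin_topspace subset_antisym)
qed

lemma quotient_map_proj_topology:
  "quotient_map (top_of_set (- {0})) proj_topology (\<lambda>v :: real^'n. span {v})"
proof -
  have "(\<lambda>v :: real^'n. span {v}) ` (- {0}) = proj_space"
    by (auto simp: proj_space_def)
  moreover have "openin (top_of_set (- {0})) {v. v \<noteq> 0 \<and> span {v} \<in> U} \<longleftrightarrow>
      open {v. v \<noteq> 0 \<and> span {v} \<in> U}" for U :: "(real^'n) set set"
    by (subst openin_open_eq) (auto simp: open_Compl)
  ultimately show ?thesis
    by (auto simp: quotient_map_def topspace_proj_topology openin_proj_topology)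
qed

definition proj_borel :: "(real^'n) set measure" where
  "proj_borel = sigma proj_space {U. openin proj_topology U}"

text \<open>The projective transformation \<open>f\<^sub>A\<close>.\<close>

definition proj_map :: "real^'n^'n \<Rightarrow> (real^'n) set \<Rightarrow> (real^'n) set" where
  "proj_map A l = (*v) A ` l"

text \<open>\<open>proj_walk A k\<close> is \<open>f\<^sub>k \<circ> \<dots> \<circ> f\<^sub>1\<close> with \<open>f\<^sub>i\<close> induced by \<open>A i\<close>; the value \<open>A 0\<close> is not used.\<close>

primrec proj_walk :: "(nat \<Rightarrow> real^'n^'n) \<Rightarrow> nat \<Rightarrow> (real^'n) set \<Rightarrow> (real^'n) set" where
  "proj_walk A 0 = id"
| "proj_walk A (Suc k) = proj_map (A (Suc k)) \<circ> proj_walk A k"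

definition SL_probs :: "(real^'n^'n) measure set" where
  "SL_probs = space (prob_algebra (restrict_space borel SL))"

definition proj_probs :: "(real^'n) set measure set" where
  "proj_probs = space (prob_algebra proj_borel)"

text \<open>The topology of weak convergence: the coarsest one for which integration of every bounded
  continuous function on \<open>SL\<close> is continuous.\<close>

definition SL_weak_topology :: "(real^'n^'n) measure topology" where
  "SL_weak_topology = topology_generated_by
     {{\<mu> \<in> SL_probs. (\<integral>A. \<phi> A \<partial>\<mu>) \<in> V} |(\<phi> :: real^'n^'n \<Rightarrow> real) V.
        continuous_on SL \<phi> \<and> bounded (\<phi> ` SL) \<and> open V}"

lemma topspace_SL_weak_topology:
  "topspace SL_weak_topology = (SL_probs :: (real^'n^'n) measure set)"
proof -
  have "SL_probs \<in> {{\<mu> \<in> SL_probs. (\<integral>A. \<phi> A \<partial>\<mu>) \<in> V} |(\<phi> :: real^'n^'n \<Rightarrow> real) V.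
        continuous_on SL \<phi> \<and> bounded (\<phi> ` SL) \<and> open V}"
    by (auto intro!: exI[of _ "\<lambda>_. 0"] exI[of _ UNIV] simp: image_constant_conv)
  then show ?thesis
    unfolding SL_weak_topology_def topology_generated_by_topspace by blast
qed

definition subspace_union :: "nat \<Rightarrow> (real^'n) set \<Rightarrow> bool" where
  "subspace_union j U \<longleftrightarrow> (\<exists>S. finite S \<and> S \<noteq> {} \<and> S \<subseteq> Gr j \<and> U = \<Union>S)"

end

theory Submission
  imports Defs
begin

text \<open>
  The walk is lifted from lines to vectors: the event in question says that
  \<open>A\<^sub>k \<dots> A\<^sub>1 v\<close> lies in \<open>L\<close>, so it suffices to bound \<open>\<nu> L\<close> for all laws \<open>\<nu>\<close> that arise
  after \<open>k\<close> steps (\<open>walk_laws K k\<close>). A law after \<open>k + 1\<close> steps gives \<open>L\<close> the \<open>\<mu>\<close>-average of the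
  weights that a law after \<open>k\<close> steps gives to the preimages \<open>A\<^sup>-\<^sup>1 L\<close> (\<open>push_props\<close>).

  The bound is proved by induction on the dimension \<open>m\<close> (\<open>weight_dissolves\<close>). Let \<open>c\<close> be the upper
  limit, as \<open>k\<close> grows, of the largest weight of an \<open>m\<close>-dimensional subspace, and suppose that
  \<open>c > 0\<close>. Two distinct \<open>m\<close>-dimensional subspaces meet in a smaller dimension, hence in small
  weight by induction, so only boundedly many of them can carry weight close to \<open>c\<close>. Let \<open>r\<close> be
  the largest number of such subspaces that occurs for arbitrarily late laws and arbitrarily
  good closeness, and let \<open>S\<close> be a set of \<open>r\<close> of them for a late law \<open>\<nu>\<^sub>1\<close> obtained from \<open>\<nu>\<close> by
  one step \<open>\<mu>\<close>. An average that is close to its maximal value is close to it at most places;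
  so for \<open>\<mu>\<close>-most \<open>A\<close> all the preimages \<open>A\<^sup>-\<^sup>1 L\<close>, \<open>L \<in> S\<close>, have \<open>\<nu>\<close>-weight close to \<open>c\<close>. By
  maximality of \<open>r\<close> there is a single set \<open>S'\<close> of \<open>r\<close> subspaces that is available for this, and
  therefore \<open>A\<close> maps \<open>S'\<close> onto \<open>S\<close> with \<open>\<mu>\<close>-probability close to \<open>1\<close> (\<open>weight_dissolves_step\<close>).

  By compactness this is impossible (\<open>subspace_family_gap\<close>): if the probability could be
  arbitrarily close to \<open>1\<close>, then in the limit some \<open>\<mu> \<in> K\<close> would almost surely map one
  finite union of \<open>m\<close>-dimensional subspaces onto another. Although \<open>SL\<close> is not compact,
  mass escaping to infinity cannot disturb the limit, because failure of \<open>A\<close> to map one family onto another is measured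
  by a function of the normalised matrix \<open>sgn A\<close>, which ranges over the compact unit sphere.
\<close>

section \<open>Laws of random matrix products applied to a vector\<close>

lemma continuous_on_matrix_vector_mult:
  fixes f :: "'a::topological_space \<Rightarrow> real^'n^'m" and g :: "'a \<Rightarrow> real^'n"
  assumes "continuous_on S f" "continuous_on S g"
  shows "continuous_on S (\<lambda>x. f x *v g x)"
  unfolding matrix_vector_mult_def using assms by (intro continuous_intros)

lemma SL_mult_vec:
  fixes A :: "real^'n^'n"
  assumes "A \<in> SL"
  shows "bij ((*v) A)" "A \<noteq> 0"
proof -
  have "invertible A" using assms by (simp add: SL_def invertible_det_nz)
  then show "bij ((*v) A)" by (simp add: invertible_eq_bij)
  show "A \<noteq> 0"
  proof
    assume "A = 0"
    then have "(*v) A = (\<lambda>_. 0)" by auto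
    with \<open>bij ((*v) A)\<close> have "axis undefined (1::real) = (0 :: real^'n)" by (simp add: bij_def inj_def)
    then show False by (simp add: axis_eq_0_iff)
  qed
qed

lemma SL_probsD:
  assumes "\<mu> \<in> SL_probs"
  shows "prob_space \<mu>" "sets \<mu> = sets (restrict_space borel SL)" "space \<mu> = SL"
proof -
  show "prob_space \<mu>" and *: "sets \<mu> = sets (restrict_space borel SL)"
    using assms by (auto simp: SL_probs_def space_prob_algebra)
  show "space \<mu> = SL" using sets_eq_imp_space_eq[OF *] by (simp add: space_restrict_space)
qed

lemma measurable_ident_SL:
  assumes "\<mu> \<in> SL_probs"
  shows "(\<lambda>A. A) \<in> borel_measurable \<mu>"
  using SL_probsD(2)[OF assms] by (simp add: measurable_cong_sets[of \<mu> _ borel borel] measurable_restrict_space1)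

definition push :: "(real^'n^'n) measure \<Rightarrow> (real^'n) measure \<Rightarrow> (real^'n) measure" where
  "push \<mu> \<nu> = distr (\<mu> \<Otimes>\<^sub>M \<nu>) borel (\<lambda>(A, v). A *v v)"

primrec walk_laws :: "(real^'n^'n) measure set \<Rightarrow> nat \<Rightarrow> (real^'n) measure set" where
  "walk_laws K 0 = {return borel v |v. v \<noteq> 0}"
| "walk_laws K (Suc k) = {push \<mu> \<nu> |\<mu> \<nu>. \<mu> \<in> K \<and> \<nu> \<in> walk_laws K k}"

lemma measurable_mult_vec:
  fixes \<mu> :: "(real^'n^'n) measure" and \<nu> :: "(real^'n) measure"
  assumes "\<mu> \<in> SL_probs" "sets \<nu> = sets borel"
  shows "(\<lambda>(A, v). A *v v) \<in> borel_measurable (\<mu> \<Otimes>\<^sub>M \<nu>)"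
proof -
  have "(\<lambda>v. v) \<in> borel_measurable \<nu>"
    using assms(2) by (simp add: measurable_cong_sets[of \<nu> borel borel borel])
  from measurable_compose[OF measurable_snd[of \<mu> \<nu>] this]
  have snd: "snd \<in> borel_measurable (\<mu> \<Otimes>\<^sub>M \<nu>)" by (simp add: comp_def)
  from measurable_compose[OF measurable_fst[of \<mu> \<nu>] measurable_ident_SL[OF assms(1)]]
  have fst: "fst \<in> borel_measurable (\<mu> \<Otimes>\<^sub>M \<nu>)" by simp
  have "continuous_on UNIV (\<lambda>x :: (real^'n^'n) \<times> (real^'n). fst x *v snd x)"
    by (intro continuous_on_matrix_vector_mult continuous_on_fst continuous_on_snd continuous_on_id)
  from borel_measurable_continuous_Pair[OF fst snd this]
  show ?thesis by (simp add: case_prod_beta)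
qed

text \<open>
  Disintegrating over the matrix turns the weight of \<open>B\<close> after one more step into an average of
  weights of preimages before it.
\<close>

lemma push_props:
  assumes \<mu>: "\<mu> \<in> SL_probs" and \<nu>: "prob_space \<nu>" "sets \<nu> = sets borel" and B: "B \<in> sets borel"
  shows "prob_space (push \<mu> \<nu>)" "sets (push \<mu> \<nu>) = sets borel"
    "(\<lambda>A. measure \<nu> ((*v) A -` B)) \<in> borel_measurable \<mu>"
    "measure (push \<mu> \<nu>) B = (\<integral>A. measure \<nu> ((*v) A -` B) \<partial>\<mu>)"
proof -
  interpret M: prob_space \<mu> by (rule SL_probsD(1)[OF \<mu>])
  interpret N: prob_space \<nu> by fact
  interpret P: pair_prob_space \<mu> \<nu> ..
  note m = measurable_mult_vec[OF \<mu> \<nu>(2)]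
  have spN: "space \<nu> = UNIV" using sets_eq_imp_space_eq[OF \<nu>(2)] by simp
  let ?X = "(\<lambda>(A, v). A *v v) -` B \<inter> space (\<mu> \<Otimes>\<^sub>M \<nu>)"
  have X: "?X \<in> sets (\<mu> \<Otimes>\<^sub>M \<nu>)" using m B by (rule measurable_sets)
  have slice: "Pair A -` ?X = (*v) A -` B" if "A \<in> space \<mu>" for A
    using that by (auto simp: space_pair_measure spN)
  show "prob_space (push \<mu> \<nu>)" unfolding push_def by (rule P.prob_space_distr[OF m])
  show "sets (push \<mu> \<nu>) = sets borel" by (simp add: push_def)
  have "(\<lambda>A. measure \<nu> (Pair A -` ?X)) \<in> borel_measurable \<mu>"
    unfolding measure_def by (rule borel_measurable_enn2real[OF N.measurable_emeasure_Pair[OF X]])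
  moreover have "(\<lambda>A. measure \<nu> (Pair A -` ?X)) \<in> borel_measurable \<mu> \<longleftrightarrow>
      (\<lambda>A. measure \<nu> ((*v) A -` B)) \<in> borel_measurable \<mu>"
    by (rule measurable_cong) (simp only: slice)
  ultimately show meas: "(\<lambda>A. measure \<nu> ((*v) A -` B)) \<in> borel_measurable \<mu>" by blast
  have "emeasure (push \<mu> \<nu>) B = emeasure (\<mu> \<Otimes>\<^sub>M \<nu>) ?X"
    unfolding push_def by (rule emeasure_distr[OF m B])
  also have "\<dots> = (\<integral>\<^sup>+A. emeasure \<nu> (Pair A -` ?X) \<partial>\<mu>)"
    by (rule N.emeasure_pair_measure_alt[OF X])
  also have "\<dots> = (\<integral>\<^sup>+A. ennreal (measure \<nu> ((*v) A -` B)) \<partial>\<mu>)"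
    by (intro nn_integral_cong) (simp only: slice N.emeasure_eq_measure)
  finally have "measure (push \<mu> \<nu>) B = enn2real (\<integral>\<^sup>+A. ennreal (measure \<nu> ((*v) A -` B)) \<partial>\<mu>)"
    by (simp only: measure_def[of "push \<mu> \<nu>"])
  also have "\<dots> = (\<integral>A. measure \<nu> ((*v) A -` B) \<partial>\<mu>)"
    by (rule integral_eq_nn_integral[OF meas, symmetric]) simp
  finally show "measure (push \<mu> \<nu>) B = (\<integral>A. measure \<nu> ((*v) A -` B) \<partial>\<mu>)" .
qed

lemma walk_laws_props:
  assumes K: "K \<subseteq> SL_probs" and "\<nu> \<in> walk_laws K k"
  shows "prob_space \<nu>" "sets \<nu> = sets borel" "measure \<nu> {0} = 0"
proof -
  have "prob_space \<nu> \<and> sets \<nu> = sets borel \<and> measure \<nu> {0} = 0"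
    using assms(2)
  proof (induction k arbitrary: \<nu>)
    case 0
    then obtain v where v: "\<nu> = return borel v" "v \<noteq> 0" by auto
    then show ?case by (simp add: prob_space_return measure_return)
  next
    case (Suc k)
    then obtain \<mu> \<nu>' where *: "\<nu> = push \<mu> \<nu>'" "\<mu> \<in> K" "\<nu>' \<in> walk_laws K k"
      unfolding walk_laws.simps by blast
    have \<mu>: "\<mu> \<in> SL_probs" using *(2) K by blast
    have IH: "prob_space \<nu>'" "sets \<nu>' = sets borel" "measure \<nu>' {0} = 0"
      using Suc.IH[OF *(3)] by blast+
    note p = push_props[OF \<mu> IH(1,2), of "{0}"]
    have "(*v) A -` {0} = {0}" if "A \<in> space \<mu>" for A
    proof -
      have "inj ((*v) A)" using SL_mult_vec(1)[of A] that SL_probsD(3)[OF \<mu>] by (simp add: bij_def)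
      then show ?thesis using injD[of "(*v) A" _ 0] by fastforce
    qed
    then have "(\<integral>A. measure \<nu>' ((*v) A -` {0}) \<partial>\<mu>) = (\<integral>A. 0 \<partial>\<mu>)"
      by (intro Bochner_Integration.integral_cong) (simp_all add: IH)
    then show ?case using p *(1) by simp
  qed
  then show "prob_space \<nu>" "sets \<nu> = sets borel" "measure \<nu> {0} = 0" by auto
qed

primrec vec_walk :: "(nat \<Rightarrow> real^'n^'n) \<Rightarrow> nat \<Rightarrow> real^'n \<Rightarrow> real^'n" where
  "vec_walk A 0 v = v"
| "vec_walk A (Suc k) v = A (Suc k) *v vec_walk A k v"

lemma proj_walk_span: "proj_walk A k (span {v}) = span {vec_walk A k v}"
proof (induction k)
  case (Suc k)
  have "(*v) (A (Suc k)) ` span {vec_walk A k v} = span ((*v) (A (Suc k)) ` {vec_walk A k v})"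
    by (rule span_linear_image[OF matrix_vector_mul_linear, symmetric])
  then show ?case using Suc by (simp add: proj_map_def)
qed simp

lemma vec_walk_cong: "(\<And>i. i \<in> {1..k} \<Longrightarrow> A i = B i) \<Longrightarrow> vec_walk A k v = vec_walk B k v"
  by (induction k) auto

text \<open>
  The last matrix is split off from the finite product measure; the remaining coordinates carry
  the law of the walk one step earlier, independently of that matrix.
\<close>

lemma vec_walk_law:
  fixes K :: "(real^'n^'n) measure set" and v :: "real^'n"
  assumes K: "K \<subseteq> SL_probs" and \<mu>: "\<And>i. i \<in> {1..k} \<Longrightarrow> \<mu> i \<in> K" and v: "v \<noteq> 0"
  shows "(\<lambda>A. vec_walk A k v) \<in> borel_measurable (PiM {1..k} \<mu>)"
    and "distr (PiM {1..k} \<mu>) borel (\<lambda>A. vec_walk A k v) \<in> walk_laws K k"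
proof -
  have "(\<lambda>A. vec_walk A k v) \<in> borel_measurable (PiM {1..k} \<mu>) \<and>
    distr (PiM {1..k} \<mu>) borel (\<lambda>A. vec_walk A k v) \<in> walk_laws K k"
    using \<mu>
  proof (induction k)
    case 0
    interpret prob_space "PiM {1..0::nat} \<mu>" by (rule prob_space_PiM) simp
    have "distr (PiM {1..0::nat} \<mu>) borel (\<lambda>A. vec_walk A 0 v) = return borel v"
      using distr_const[of v borel] by simp
    then show ?case using v by (simp, blast)
  next
    case (Suc k)
    let ?P = "PiM {1..k} \<mu>" and ?m = "\<mu> (Suc k)"
    have m: "?m \<in> K" "?m \<in> SL_probs" using Suc.prems K by auto
    have pr: "prob_space (\<mu> i)" if "i \<in> {1..Suc k}" for i
      using Suc.prems[OF that] K SL_probsD(1) by blast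
    have IH: "(\<lambda>A. vec_walk A k v) \<in> borel_measurable ?P"
      "distr ?P borel (\<lambda>A. vec_walk A k v) \<in> walk_laws K k"
      using Suc.IH Suc.prems by simp_all
    have ins: "{1..Suc k} = insert (Suc k) {1..k}" by auto
    have sfin: "sigma_finite_measure (distr ?P borel (\<lambda>A. vec_walk A k v))"
      using walk_laws_props(1)[OF K IH(2)]
      by (simp add: prob_space_def finite_measure_def)
    have pair: "PiM {1..Suc k} \<mu> = distr (?m \<Otimes>\<^sub>M ?P) (PiM {1..Suc k} \<mu>) (\<lambda>(x, X). X(Suc k := x))"
      unfolding ins by (rule distr_pair_PiM_eq_PiM[symmetric]) (auto intro!: pr)
    have upd_walk: "vec_walk (X(Suc k := x)) k v = vec_walk X k v" for x and X :: "nat \<Rightarrow> real^'n^'n"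
      by (rule vec_walk_cong) auto
    have upd: "(\<lambda>(x, X). X(Suc k := x)) \<in> measurable (?m \<Otimes>\<^sub>M ?P) (PiM {1..Suc k} \<mu>)"
      unfolding ins by measurable
    have id: "(\<lambda>A. A) \<in> borel_measurable ?m" by (rule measurable_ident_SL[OF m(2)])
    have restr: "(\<lambda>X. restrict X {1..k}) \<in> measurable (PiM {1..Suc k} \<mu>) ?P"
      by (rule measurable_restrict_subset) auto
    have "(\<lambda>X. vec_walk (restrict X {1..k}) k v) \<in> borel_measurable (PiM {1..Suc k} \<mu>)"
      using measurable_compose[OF restr IH(1)] .
    moreover have "vec_walk (restrict X {1..k}) k v = vec_walk X k v" for X :: "nat \<Rightarrow> real^'n^'n"
      by (rule vec_walk_cong) auto
    ultimately have mk: "(\<lambda>X. vec_walk X k v) \<in> borel_measurable (PiM {1..Suc k} \<mu>)" by simp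
    have "(\<lambda>X. X (Suc k)) \<in> measurable (PiM {1..Suc k} \<mu>) ?m"
      by (rule measurable_component_singleton) simp
    from measurable_compose[OF this id]
    have "(\<lambda>X. X (Suc k)) \<in> borel_measurable (PiM {1..Suc k} \<mu>)" .
    then have meas: "(\<lambda>X. vec_walk X (Suc k) v) \<in> borel_measurable (PiM {1..Suc k} \<mu>)"
      unfolding vec_walk.simps
      by (rule borel_measurable_continuous_Pair[OF _ mk])
        (intro continuous_on_matrix_vector_mult continuous_on_fst continuous_on_snd continuous_on_id)
    have "distr (PiM {1..Suc k} \<mu>) borel (\<lambda>A. vec_walk A (Suc k) v) =
        distr (?m \<Otimes>\<^sub>M ?P) borel (\<lambda>(x, X). x *v vec_walk X k v)"
      by (subst pair, subst distr_distr[OF meas upd])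
        (intro distr_cong refl, simp add: case_prod_beta upd_walk)
    also have "\<dots> = push ?m (distr ?P borel (\<lambda>A. vec_walk A k v))"
    proof -
      let ?N = "distr ?P borel (\<lambda>A. vec_walk A k v)"
      have mm: "(\<lambda>(x, X). (x, vec_walk X k v)) \<in> measurable (?m \<Otimes>\<^sub>M ?P) (?m \<Otimes>\<^sub>M borel)"
        using IH(1) by measurable
      have "?m \<Otimes>\<^sub>M ?N = distr ?m ?m (\<lambda>x. x) \<Otimes>\<^sub>M ?N" by simp
      also have "\<dots> = distr (?m \<Otimes>\<^sub>M ?P) (?m \<Otimes>\<^sub>M borel) (\<lambda>(x, X). (x, vec_walk X k v))"
        by (rule pair_measure_distr[OF _ IH(1) sfin]) simp
      finally have e: "?m \<Otimes>\<^sub>M ?N = \<dots>" .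
      have mv: "(\<lambda>(A, v). A *v v) \<in> borel_measurable (?m \<Otimes>\<^sub>M borel)"
        by (rule measurable_mult_vec[OF m(2)]) simp
      show ?thesis
        unfolding push_def e by (subst distr_distr[OF mv mm]) (intro distr_cong refl, simp add: case_prod_beta)
    qed
    finally show ?case using meas m(1) IH(2) unfolding walk_laws.simps by blast
  qed
  then show "(\<lambda>A. vec_walk A k v) \<in> borel_measurable (PiM {1..k} \<mu>)"
    "distr (PiM {1..k} \<mu>) borel (\<lambda>A. vec_walk A k v) \<in> walk_laws K k" by auto
qed

text \<open>
  A line \<open>span {w}\<close> lies in \<open>L\<close> only if \<open>w\<close> does.
\<close>

lemma measure_proj_walk_le:
  fixes K :: "(real^'n^'n) measure set" and v :: "real^'n"
  assumes K: "K \<subseteq> SL_probs" and \<mu>: "\<And>i. i \<in> {1..k} \<Longrightarrow> \<mu> i \<in> K" and v: "v \<noteq> 0"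
    and L: "subspace L"
  shows "\<exists>\<nu>\<in>walk_laws K k. measure (PiM {1..k} \<mu>)
      {A \<in> space (PiM {1..k} \<mu>). proj_walk A k (span {v}) \<in> proj_subspace L} \<le> measure \<nu> L"
proof (rule bexI[OF _ vec_walk_law(2)[OF K \<mu> v]])
  interpret prob_space "PiM {1..k} \<mu>"
    by (rule prob_space_PiM) (use \<mu> K SL_probsD(1) in auto)
  note m = vec_walk_law(1)[OF K \<mu> v]
  have B: "L \<in> sets borel" using closed_subspace[OF L] by simp
  have "measure (PiM {1..k} \<mu>)
      {A \<in> space (PiM {1..k} \<mu>). proj_walk A k (span {v}) \<in> proj_subspace L}
    \<le> measure (PiM {1..k} \<mu>) ((\<lambda>A. vec_walk A k v) -` L \<inter> space (PiM {1..k} \<mu>))"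
    using measurable_sets[OF m B] span_superset
    by (intro finite_measure_mono) (fastforce simp: proj_walk_span proj_subspace_def)+
  also have "\<dots> = measure (distr (PiM {1..k} \<mu>) borel (\<lambda>A. vec_walk A k v)) L"
    by (rule measure_distr[OF m B, symmetric])
  finally show "measure (PiM {1..k} \<mu>)
      {A \<in> space (PiM {1..k} \<mu>). proj_walk A k (span {v}) \<in> proj_subspace L}
    \<le> measure (distr (PiM {1..k} \<mu>) borel (\<lambda>A. vec_walk A k v)) L" .
qed

section \<open>Finite families of subspaces and matrices that map one onto another\<close>

text \<open>
  Orthonormal \<open>m\<close>-tuples parametrise the \<open>m\<close>-dimensional subspaces by a compact set. The tuples are
  infinite sequences so that \<open>m\<close> can vary within one type; the norm bound on the entries beyond \<open>m\<close>
  keeps the set compact in the product topology.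
\<close>

definition frames :: "nat \<Rightarrow> (nat \<Rightarrow> real^'n) set" where
  "frames m = {e. (\<forall>i. norm (e i) \<le> 1) \<and> (\<forall>i<m. \<forall>j<m. e i \<bullet> e j = (if i = j then 1 else 0))}"

definition frame_span :: "nat \<Rightarrow> (nat \<Rightarrow> real^'n) \<Rightarrow> (real^'n) set" where
  "frame_span m e = span (e ` {..<m})"

lemma compact_Pi_UNIV:
  fixes S :: "'i \<Rightarrow> 'a::topological_space set"
  assumes "\<And>i. compact (S i)"
  shows "compact {f. \<forall>i. f i \<in> S i}"
proof -
  have "compactin (product_topology (\<lambda>i. euclidean) UNIV) (PiE UNIV S)"
    unfolding compactin_PiE using assms by auto
  moreover have "PiE UNIV S = {f. \<forall>i. f i \<in> S i}" by (auto simp: PiE_def Pi_def)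
  ultimately show ?thesis by (simp add: euclidean_product_topology)
qed

lemma compact_frames: "compact (frames m :: (nat \<Rightarrow> real^'n) set)"
proof -
  have "frames m = {e :: nat \<Rightarrow> real^'n. \<forall>i. e i \<in> cball 0 1} \<inter>
      (\<Inter>i<m. \<Inter>j<m. {e. e i \<bullet> e j = (if i = j then 1 else 0)})"
    by (auto simp: frames_def)
  moreover have "closed {e :: nat \<Rightarrow> real^'n. e i \<bullet> e j = (if i = j then 1 else 0)}" for i j
    by (intro closed_Collect_eq continuous_intros) auto
  ultimately show ?thesis
    using compact_Pi_UNIV[of "\<lambda>_::nat. cball (0::real^'n) 1"] by (auto intro!: compact_Int_closed closed_INT)
qed

lemma frame_span_Gr:
  assumes "e \<in> frames m"
  shows "frame_span m e \<in> Gr m"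
proof -
  have ip: "e i \<bullet> e j = (if i = j then 1 else 0)" if "i < m" "j < m" for i j
    using assms that by (auto simp: frames_def)
  have inj: "inj_on e {..<m}"
    by (rule inj_onI) (metis ip lessThan_iff zero_neq_one)
  have "independent (e ` {..<m})"
    by (rule pairwise_orthogonal_independent)
      (auto simp: pairwise_def orthogonal_def ip, metis inner_zero_left ip zero_neq_one)
  then have "dim (span (e ` {..<m})) = card (e ` {..<m})"
    by (simp add: dim_eq_card_independent)
  then show ?thesis using card_image[OF inj] by (simp add: Gr_def frame_span_def)
qed

lemma frame_exists:
  assumes "L \<in> Gr m"
  shows "\<exists>e\<in>frames m. frame_span m e = (L :: (real^'n) set)"
proof -
  have L: "subspace L" "dim L = m" using assms by (auto simp: Gr_def)
  obtain B where B: "pairwise orthogonal B" "\<And>x. x \<in> B \<Longrightarrow> norm x = 1" "independent B"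
    "card B = dim L" "span B = L"
    using orthonormal_basis_subspace[OF L(1)] by metis
  have "finite B" using B(3) by (rule independent_imp_finite)
  then obtain h where h: "bij_betw h {0..<m} B"
    using ex_bij_betw_nat_finite[of B] B(4) L(2) by auto
  define e where "e i = (if i < m then h i else 0)" for i
  have im: "e ` {..<m} = B" using h by (auto simp: e_def bij_betw_def)
  have hB: "h i \<in> B" if "i < m" for i using h that by (auto simp: bij_betw_def)
  have "h i \<bullet> h j = (if i = j then 1 else 0)" if "i < m" "j < m" for i j
  proof (cases "i = j")
    case True
    then show ?thesis using B(2)[OF hB[OF that(1)]] by (simp add: norm_eq_1)
  next
    case False
    then have "h i \<noteq> h j" using h that by (auto simp: bij_betw_def inj_on_def)
    then show ?thesis using B(1) hB that False by (auto simp: pairwise_def orthogonal_def)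
  qed
  then have "e \<in> frames m" using hB B(2) by (auto simp: frames_def e_def)
  then show ?thesis using im B(5) by (auto simp: frame_span_def)
qed

text \<open>
  For orthonormal \<open>e\<close>, the sum of the distances from the vectors \<open>B e'\<^sub>i\<close> to the span of \<open>e\<close>.
\<close>

definition defect :: "nat \<Rightarrow> (nat \<Rightarrow> real^'n) \<Rightarrow> (nat \<Rightarrow> real^'n) \<Rightarrow> real^'n^'n \<Rightarrow> real" where
  "defect m e e' B = (\<Sum>i<m. norm (B *v e' i - (\<Sum>j<m. ((B *v e' i) \<bullet> e j) *\<^sub>R e j)))"

lemma defect_nonneg: "0 \<le> defect m e e' B"
  by (simp add: defect_def sum_nonneg)

lemma frame_expansion:
  assumes e: "e \<in> frames m"
  shows "w = (\<Sum>j<m. (w \<bullet> e j) *\<^sub>R e j) \<longleftrightarrow> w \<in> frame_span m e"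
proof
  assume "w = (\<Sum>j<m. (w \<bullet> e j) *\<^sub>R e j)"
  moreover have "(\<Sum>j<m. (w \<bullet> e j) *\<^sub>R e j) \<in> frame_span m e"
    unfolding frame_span_def by (intro span_sum span_scale span_base) auto
  ultimately show "w \<in> frame_span m e" by simp
next
  assume "w \<in> frame_span m e"
  then have "w \<in> span (e ` {..<m})" by (simp add: frame_span_def)
  then show "w = (\<Sum>j<m. (w \<bullet> e j) *\<^sub>R e j)"
  proof (induction rule: span_induct_alt)
    case base
    then show ?case by simp
  next
    case (step c x y)
    then obtain i where i: "i < m" "x = e i" by auto
    have "(\<Sum>j<m. (e i \<bullet> e j) *\<^sub>R e j) = (\<Sum>j<m. if i = j then e j else 0)"
      using e i by (intro sum.cong) (auto simp: frames_def)
    also have "\<dots> = e i" using i by simp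
    finally have x: "(\<Sum>j<m. (x \<bullet> e j) *\<^sub>R e j) = x" using i by simp
    have "(\<Sum>j<m. ((c *\<^sub>R x + y) \<bullet> e j) *\<^sub>R e j) =
        c *\<^sub>R (\<Sum>j<m. (x \<bullet> e j) *\<^sub>R e j) + (\<Sum>j<m. (y \<bullet> e j) *\<^sub>R e j)"
      by (simp add: inner_add_left scaleR_add_left sum.distrib scaleR_sum_right)
    then show ?case using x step.IH by simp
  qed
qed

lemma defect_eq_0_iff:
  assumes e: "e \<in> frames m"
  shows "defect m e e' B = 0 \<longleftrightarrow> (*v) B ` frame_span m e' \<subseteq> frame_span m e"
proof -
  have "defect m e e' B = 0 \<longleftrightarrow> (\<forall>i<m. B *v e' i = (\<Sum>j<m. ((B *v e' i) \<bullet> e j) *\<^sub>R e j))"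
    unfolding defect_def by (subst sum_nonneg_eq_0_iff) auto
  also have "\<dots> \<longleftrightarrow> (*v) B ` (e' ` {..<m}) \<subseteq> frame_span m e"
    using frame_expansion[OF e] by auto
  also have "\<dots> \<longleftrightarrow> span ((*v) B ` (e' ` {..<m})) \<subseteq> frame_span m e"
    unfolding frame_span_def by (metis span_mono span_span span_superset subset_trans)
  also have "span ((*v) B ` (e' ` {..<m})) = (*v) B ` frame_span m e'"
    unfolding frame_span_def by (rule span_linear_image[OF matrix_vector_mul_linear])
  finally show ?thesis .
qed

lemma defect_scaleR: "defect m e e' (c *\<^sub>R B) = \<bar>c\<bar> * defect m e e' B"
proof -
  have "(c *\<^sub>R B) *v e' i - (\<Sum>j<m. (((c *\<^sub>R B) *v e' i) \<bullet> e j) *\<^sub>R e j) =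
     c *\<^sub>R (B *v e' i - (\<Sum>j<m. ((B *v e' i) \<bullet> e j) *\<^sub>R e j))" for i
    by (simp add: scaleR_matrix_vector_assoc[symmetric] scaleR_diff_right scaleR_sum_right)
  then show ?thesis by (simp add: defect_def sum_distrib_left)
qed

text \<open>
  Rescaling the matrix does not change where it maps subspaces, and for an invertible matrix
  inclusion of the image is equality by dimension.
\<close>

lemma defect_sgn_eq_0_iff:
  assumes e: "e \<in> frames m" and e': "e' \<in> frames m" and A: "A \<in> SL"
  shows "defect m e e' (sgn A) = 0 \<longleftrightarrow> (*v) A ` frame_span m e' = frame_span m e"
proof -
  have "defect m e e' (sgn A) = 0 \<longleftrightarrow> defect m e e' A = 0"
    using SL_mult_vec(2)[OF A] by (simp add: sgn_div_norm defect_scaleR)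
  also have "\<dots> \<longleftrightarrow> (*v) A ` frame_span m e' \<subseteq> frame_span m e" by (rule defect_eq_0_iff[OF e])
  also have "\<dots> \<longleftrightarrow> (*v) A ` frame_span m e' = frame_span m e"
  proof
    assume sub: "(*v) A ` frame_span m e' \<subseteq> frame_span m e"
    have g: "subspace (frame_span m e)" "dim (frame_span m e) = m"
      "subspace (frame_span m e')" "dim (frame_span m e') = m"
      using frame_span_Gr[OF e] frame_span_Gr[OF e'] by (auto simp: Gr_def)
    have "inj ((*v) A)" using SL_mult_vec(1)[OF A] by (simp add: bij_def)
    then have "dim ((*v) A ` frame_span m e') = m"
      using dim_image_eq[OF matrix_vector_mul_linear, of A "frame_span m e'"] g
      by (simp add: inj_on_subset)
    moreover have "subspace ((*v) A ` frame_span m e')"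
      using g(3) by (rule linear_subspace_image[OF matrix_vector_mul_linear])
    ultimately show "(*v) A ` frame_span m e' = frame_span m e"
      using g sub by (intro subspace_dim_equal) auto
  qed auto
  finally show ?thesis .
qed

definition frame_family :: "nat \<Rightarrow> nat \<Rightarrow> (nat \<Rightarrow> nat \<Rightarrow> real^'n) \<Rightarrow> (real^'n) set set" where
  "frame_family m r E = (\<lambda>i. frame_span m (E i)) ` {..<r}"

text \<open>
  The first sum vanishes if every subspace of the second family is mapped to some member of the
  first one, the second sum if every member of the first family is reached. Repetitions within
  a family are harmless, which matters because distinct subspaces may collide in a limit.
\<close>

definition family_defect ::
    "nat \<Rightarrow> nat \<Rightarrow> (nat \<Rightarrow> nat \<Rightarrow> real^'n) \<Rightarrow> (nat \<Rightarrow> nat \<Rightarrow> real^'n) \<Rightarrow> real^'n^'n \<Rightarrow> real" where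
  "family_defect m r E E' B =
    (\<Sum>i<r. \<Prod>j<r. defect m (E j) (E' i) B) + (\<Sum>j<r. \<Prod>i<r. defect m (E j) (E' i) B)"

lemma sum_prod_eq_0_iff:
  fixes f :: "nat \<Rightarrow> nat \<Rightarrow> real"
  assumes "\<And>i j. 0 \<le> f i j"
  shows "(\<Sum>i<r. \<Prod>j<r. f i j) = 0 \<longleftrightarrow> (\<forall>i<r. \<exists>j<r. f i j = 0)"
proof -
  have "(\<Sum>i<r. \<Prod>j<r. f i j) = 0 \<longleftrightarrow> (\<forall>i\<in>{..<r}. (\<Prod>j<r. f i j) = 0)"
    using assms by (intro sum_nonneg_eq_0_iff prod_nonneg) simp_all
  also have "\<dots> \<longleftrightarrow> (\<forall>i<r. \<exists>j<r. f i j = 0)" by auto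
  finally show ?thesis .
qed

lemma family_defect_nonneg: "0 \<le> family_defect m r E E' B"
  by (simp add: family_defect_def sum_nonneg prod_nonneg defect_nonneg)

lemma family_defect_eq_0_iff:
  assumes E: "\<And>i. E i \<in> frames m" and E': "\<And>i. E' i \<in> frames m" and A: "A \<in> SL"
  shows "family_defect m r E E' (sgn A) = 0 \<longleftrightarrow>
    (`) ((*v) A) ` frame_family m r E' = frame_family m r E"
proof -
  have "family_defect m r E E' (sgn A) = 0 \<longleftrightarrow>
      (\<forall>i<r. \<exists>j<r. defect m (E j) (E' i) (sgn A) = 0) \<and>
      (\<forall>j<r. \<exists>i<r. defect m (E j) (E' i) (sgn A) = 0)"
    unfolding family_defect_def
    using sum_prod_eq_0_iff[of "\<lambda>i j. defect m (E j) (E' i) (sgn A)" r]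
      sum_prod_eq_0_iff[of "\<lambda>j i. defect m (E j) (E' i) (sgn A)" r]
    by (subst add_nonneg_eq_0_iff) (simp_all add: sum_nonneg prod_nonneg defect_nonneg)
  also have "\<dots> \<longleftrightarrow>
      (\<forall>i<r. \<exists>j<r. (*v) A ` frame_span m (E' i) = frame_span m (E j)) \<and>
      (\<forall>j<r. \<exists>i<r. (*v) A ` frame_span m (E' i) = frame_span m (E j))"
    by (simp add: defect_sgn_eq_0_iff[OF E E' A])
  also have "\<dots> \<longleftrightarrow> (`) ((*v) A) ` frame_family m r E' = frame_family m r E"
    (is "?l \<longleftrightarrow> ?r")
  proof
    assume l: ?l
    show ?r
    proof
      show "(`) ((*v) A) ` frame_family m r E' \<subseteq> frame_family m r E"
        using l unfolding frame_family_def by blast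
      show "frame_family m r E \<subseteq> (`) ((*v) A) ` frame_family m r E'"
      proof
        fix L assume "L \<in> frame_family m r E"
        then obtain j where "j < r" "L = frame_span m (E j)" by (auto simp: frame_family_def)
        then obtain i where "i < r" "L = (*v) A ` frame_span m (E' i)" using l by metis
        then show "L \<in> (`) ((*v) A) ` frame_family m r E'" by (simp add: frame_family_def)
      qed
    qed
  next
    assume R: ?r
    show ?l
    proof (intro conjI allI impI)
      fix i assume "i < r"
      then have "(*v) A ` frame_span m (E' i) \<in> (`) ((*v) A) ` frame_family m r E'"
        by (simp add: frame_family_def)
      then show "\<exists>j<r. (*v) A ` frame_span m (E' i) = frame_span m (E j)"
        unfolding R by (auto simp: frame_family_def)
    next
      fix j assume "j < r"
      then have "frame_span m (E j) \<in> frame_family m r E" by (simp add: frame_family_def)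
      then show "\<exists>i<r. (*v) A ` frame_span m (E' i) = frame_span m (E j)"
        unfolding R[symmetric] by (auto simp: frame_family_def)
    qed
  qed
  finally show ?thesis .
qed

lemma continuous_on_family_defect:
  "continuous_on S (\<lambda>((E, E'), B). family_defect m r E E' B)"
proof -
  have c1: "continuous_on S (\<lambda>p::((nat \<Rightarrow> nat \<Rightarrow> real^'n) \<times> (nat \<Rightarrow> nat \<Rightarrow> real^'n)) \<times> (real^'n^'n). fst (fst p) i j)"
    "continuous_on S (\<lambda>p::((nat \<Rightarrow> nat \<Rightarrow> real^'n) \<times> (nat \<Rightarrow> nat \<Rightarrow> real^'n)) \<times> (real^'n^'n). snd (fst p) i j)" for S i j
    by (rule continuous_on_product_then_coordinatewise, rule continuous_on_product_then_coordinatewise,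
        intro continuous_on_fst continuous_on_snd continuous_on_id)+
  show ?thesis
    unfolding case_prod_beta family_defect_def defect_def
    by (intro continuous_intros continuous_on_matrix_vector_mult c1)
qed

lemma frame_family_exists:
  fixes S :: "(real^'n) set set"
  assumes S: "S \<subseteq> Gr m" "card S = r" "r > 0"
  shows "\<exists>E. (\<forall>i. E i \<in> frames m) \<and> frame_family m r E = S"
proof -
  have "finite S" using S by (simp add: card_ge_0_finite)
  from ex_bij_betw_nat_finite[OF this] obtain h where h: "bij_betw h {0..<r} S"
    unfolding S(2) by blast
  have "\<forall>L\<in>Gr m. \<exists>e. e \<in> frames m \<and> frame_span m e = (L :: (real^'n) set)"
    using frame_exists by blast
  from bchoice[OF this] obtain f where
    f: "\<And>L :: (real^'n) set. L \<in> Gr m \<Longrightarrow> f L \<in> frames m \<and> frame_span m (f L) = L"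
    by auto
  have im: "h ` {..<r} = S" using h by (simp add: bij_betw_def lessThan_atLeast0)
  have hS: "h i \<in> Gr m" if "i < r" for i
    using im S(1) that by blast
  define E where "E i = f (h (if i < r then i else 0))" for i
  have "E i \<in> frames m" for i unfolding E_def using S(3) by (intro f[THEN conjunct1] hS) simp
  moreover have "frame_family m r E = h ` {..<r}"
    unfolding frame_family_def by (rule image_cong) (simp_all add: E_def f hS)
  ultimately show ?thesis using im by blast
qed

section \<open>A uniform gap from weak compactness\<close>

lemma continuous_map_integral_SL:
  fixes \<phi> :: "real^'n^'n \<Rightarrow> real"
  assumes "continuous_on SL \<phi>" "bounded (\<phi> ` SL)"
  shows "continuous_map SL_weak_topology euclidean (\<lambda>\<mu>. \<integral>A. \<phi> A \<partial>\<mu>)"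
  unfolding continuous_map_def
proof -
  show "(\<lambda>\<mu>. \<integral>A. \<phi> A \<partial>\<mu>) \<in> topspace SL_weak_topology \<rightarrow> topspace euclidean \<and>
    (\<forall>V. openin euclidean V \<longrightarrow>
      openin SL_weak_topology {\<mu> \<in> topspace SL_weak_topology. (\<integral>A. \<phi> A \<partial>\<mu>) \<in> V})"
  proof (intro conjI allI impI)
    fix V :: "real set" assume "openin euclidean V"
    then show "openin SL_weak_topology {\<mu> \<in> topspace SL_weak_topology. (\<integral>A. \<phi> A \<partial>\<mu>) \<in> V}"
      using assms unfolding topspace_SL_weak_topology unfolding SL_weak_topology_def
      by (intro topology_generated_by_Basis) auto
  qed auto
qed

text \<open>
  Two kinds of compactness are combined. For a fixed parameter the integral is a weakly continuous
  function of \<open>\<mu>\<close> and attains its infimum on \<open>K\<close>. Along a convergent sequence of parameters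
  the integrands converge uniformly in \<open>A\<close>, since \<open>\<Psi>\<close> is uniformly continuous on the
  compact set \<open>C \<times> sphere 0 1\<close>; so an infimum \<open>0\<close> over all parameters would be attained at the
  limit parameter, where the nonnegative integrand would vanish almost everywhere.
\<close>

lemma compact_family_integral_gap:
  fixes \<Psi> :: "'a::metric_space \<Rightarrow> real^'n^'n \<Rightarrow> real"
  assumes K: "compactin SL_weak_topology K" and C: "compact C"
    and cont: "continuous_on (C \<times> sphere 0 1) (\<lambda>(c, B). \<Psi> c B)"
    and nonneg: "\<And>c B. 0 \<le> \<Psi> c B"
    and pos: "\<And>c \<mu>. c \<in> C \<Longrightarrow> \<mu> \<in> K \<Longrightarrow> \<not> (AE A in \<mu>. \<Psi> c (sgn A) = 0)"
  shows "\<exists>\<delta>>0. \<forall>c\<in>C. \<forall>\<mu>\<in>K. \<delta> \<le> (\<integral>A. \<Psi> c (sgn A) \<partial>\<mu>)"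
proof (rule ccontr)
  assume no: "\<not> ?thesis"
  have KS: "K \<subseteq> SL_probs" using compactin_subset_topspace[OF K] by (simp add: topspace_SL_weak_topology)
  have comp: "compact (C \<times> sphere (0::real^'n^'n) 1)" by (intro compact_Times C compact_sphere)
  have uc: "uniformly_continuous_on (C \<times> sphere 0 1) (\<lambda>(c, B). \<Psi> c B)"
    by (rule compact_uniformly_continuous[OF cont comp])
  have sgnS: "sgn A \<in> sphere 0 1" if "A \<in> SL" for A :: "real^'n^'n"
    using SL_mult_vec(2)[OF that] by (simp add: norm_sgn)
  have sgnc: "continuous_on SL (sgn :: real^'n^'n \<Rightarrow> _)"
    using SL_mult_vec(2) by (intro continuous_on_sgn[OF continuous_on_id]) blast
  have contc: "continuous_on SL (\<lambda>A. \<Psi> c (sgn A))" if "c \<in> C" for c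
  proof -
    have "continuous_on SL (\<lambda>A :: real^'n^'n. (c, sgn A))"
      by (intro continuous_on_Pair continuous_on_const sgnc)
    moreover have "(\<lambda>A :: real^'n^'n. (c, sgn A)) ` SL \<subseteq> C \<times> sphere 0 1"
      using that sgnS by (intro image_subsetI SigmaI)
    ultimately show ?thesis using continuous_on_compose2[OF cont, of SL "\<lambda>A. (c, sgn A)"] by simp
  qed
  obtain M where M: "\<And>c B. c \<in> C \<Longrightarrow> B \<in> sphere 0 1 \<Longrightarrow> norm (\<Psi> c B) \<le> M"
    using compact_imp_bounded[OF compact_continuous_image[OF cont comp]] by (fastforce simp: bounded_iff)
  have bndc: "bounded ((\<lambda>A. \<Psi> c (sgn A)) ` SL)" if "c \<in> C" for c
    using M[OF that sgnS] by (auto simp: bounded_iff)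
  have int: "integrable \<mu> (\<lambda>A. \<Psi> c (sgn A))" if "c \<in> C" "\<mu> \<in> K" for c \<mu>
  proof -
    have \<mu>: "\<mu> \<in> SL_probs" using that KS by auto
    interpret prob_space \<mu> by (rule SL_probsD(1)[OF \<mu>])
    have "(\<lambda>A. \<Psi> c (sgn A)) \<in> borel_measurable \<mu>"
      using borel_measurable_continuous_on_restrict[OF contc[OF that(1)]] SL_probsD(2)[OF \<mu>]
      by (simp add: measurable_cong_sets[of \<mu> "restrict_space borel SL" borel borel])
    then show ?thesis
      using M[OF that(1) sgnS] SL_probsD(3)[OF \<mu>] by (intro integrable_const_bound[of _ M]) auto
  qed
  have "\<exists>c\<in>C. \<exists>\<mu>\<in>K. (\<integral>A. \<Psi> c (sgn A) \<partial>\<mu>) < inverse (real (Suc n))" for n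
    using no by (auto simp: not_le dest!: spec[of _ "inverse (real (Suc n))"])
  then obtain c \<mu> where c: "\<And>n. c n \<in> C" and \<mu>: "\<And>n. \<mu> n \<in> K"
    and small: "\<And>n. (\<integral>A. \<Psi> (c n) (sgn A) \<partial>\<mu> n) < inverse (real (Suc n))"
    by metis
  obtain l s where l: "l \<in> C" and s: "strict_mono s" "(c \<circ> s) \<longlonglongrightarrow> l"
    using C c unfolding compact_def by metis
  let ?F = "\<lambda>\<mu>. \<integral>A. \<Psi> l (sgn A) \<partial>\<mu>"
  have "compact (?F ` K)"
    using image_compactin[OF K continuous_map_integral_SL[OF contc[OF l] bndc[OF l]]] by simp
  moreover have "?F ` K \<noteq> {}" using \<mu> by auto
  ultimately obtain \<mu>0 where \<mu>0: "\<mu>0 \<in> K" "\<And>\<mu>. \<mu> \<in> K \<Longrightarrow> ?F \<mu>0 \<le> ?F \<mu>"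
    using compact_attains_inf[of "?F ` K"] by auto
  have "?F \<mu>0 \<le> t" if "t > 0" for t
  proof -
    obtain d where d: "d > 0" "\<And>x y. x \<in> C \<times> sphere 0 1 \<Longrightarrow> y \<in> C \<times> sphere 0 1 \<Longrightarrow>
        dist x y < d \<Longrightarrow> dist (case x of (c, B) \<Rightarrow> \<Psi> c B) (case y of (c, B) \<Rightarrow> \<Psi> c B) < t / 2"
      using uc \<open>t > 0\<close> unfolding uniformly_continuous_on_def
      by (metis half_gt_zero dist_commute)
    have "\<forall>\<^sub>F n in sequentially. dist ((c \<circ> s) n) l < d" using s(2) d(1) by (rule tendstoD)
    moreover have "\<forall>\<^sub>F n in sequentially. inverse (real (Suc n)) < t / 2"
      using order_tendstoD(2)[OF LIMSEQ_inverse_real_of_nat, of "t / 2"] \<open>t > 0\<close> by simp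
    ultimately have "\<forall>\<^sub>F n in sequentially. dist ((c \<circ> s) n) l < d \<and> inverse (real (Suc n)) < t / 2"
      by eventually_elim auto
    then obtain n where n: "dist (c (s n)) l < d" "inverse (real (Suc n)) < t / 2"
      by (auto simp: eventually_sequentially)
    let ?\<mu> = "\<mu> (s n)"
    have \<mu>S: "?\<mu> \<in> SL_probs" using \<mu> KS by auto
    interpret prob_space ?\<mu> by (rule SL_probsD(1)[OF \<mu>S])
    have "\<Psi> l (sgn A) \<le> \<Psi> (c (s n)) (sgn A) + t / 2" if "A \<in> SL" for A
    proof -
      have "dist (\<Psi> (c (s n)) (sgn A)) (\<Psi> l (sgn A)) < t / 2"
        using d(2)[of "(c (s n), sgn A)" "(l, sgn A)"] that c l sgnS n
        by (simp add: dist_Pair_Pair)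
      then show ?thesis unfolding dist_real_def by linarith
    qed
    then have "?F ?\<mu> \<le> (\<integral>A. \<Psi> (c (s n)) (sgn A) + t / 2 \<partial>?\<mu>)"
      using SL_probsD(3)[OF \<mu>S] int[OF l \<mu>] int[OF c \<mu>] by (intro integral_mono) auto
    also have "\<dots> = (\<integral>A. \<Psi> (c (s n)) (sgn A) \<partial>?\<mu>) + t / 2"
      using int[OF c \<mu>] by (simp add: prob_space)
    also have "\<dots> \<le> t"
    proof -
      have "inverse (real (Suc (s n))) \<le> inverse (real (Suc n))"
        using seq_suble[OF s(1), of n] by (intro le_imp_inverse_le) auto
      then show ?thesis using small[of "s n"] n(2) by linarith
    qed
    finally show ?thesis using \<mu>0(2)[OF \<mu>] by (meson order_trans)
  qed
  then have "?F \<mu>0 \<le> 0" by (meson dense_ge)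
  moreover have "?F \<mu>0 \<ge> 0" by (simp add: nonneg)
  ultimately have "?F \<mu>0 = 0" by simp
  then have "AE A in \<mu>0. \<Psi> l (sgn A) = 0"
    using integral_nonneg_eq_0_iff_AE[OF int[OF l \<mu>0(1)]] nonneg by simp
  then show False using pos[OF l \<mu>0(1)] by simp
qed

text \<open>
  The defect of a pair of families is positive on a non-null set for each \<open>\<mu> \<in> K\<close>, hence has
  integral at least some \<open>\<delta> > 0\<close> uniformly. It vanishes on \<open>H\<close> and is bounded by some \<open>M\<close>
  elsewhere, so the complement of \<open>H\<close> has measure at least \<open>\<delta> / M\<close>.
\<close>

lemma subspace_family_gap:
  fixes K :: "(real^'n^'n) measure set"
  assumes K: "compactin SL_weak_topology K" and r: "r > 0"
    and no_subspaces: "\<not> (\<exists>\<mu>\<in>K. \<exists>U U'. subspace_union m U \<and> subspace_union m U' \<and>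
            (AE A in \<mu>. (*v) A ` U = U'))"
  shows "\<exists>\<eta>>0. \<forall>\<mu>\<in>K. \<forall>S S' H. S \<subseteq> Gr m \<and> card S = r \<and> S' \<subseteq> Gr m \<and> card S' = r \<and>
      H \<in> sets \<mu> \<and> (\<forall>A\<in>H. (`) ((*v) A) ` S' = S) \<longrightarrow> measure \<mu> H \<le> 1 - \<eta>"
proof -
  have KS: "K \<subseteq> SL_probs" using compactin_subset_topspace[OF K] by (simp add: topspace_SL_weak_topology)
  let ?fr = "{E :: nat \<Rightarrow> nat \<Rightarrow> real^'n. \<forall>i. E i \<in> frames m}"
  let ?\<Psi> = "\<lambda>(E, E'). family_defect m r E E'"
  have C: "compact (?fr \<times> ?fr)"
    by (intro compact_Times compact_Pi_UNIV compact_frames)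
  have cont: "continuous_on X (\<lambda>(c, B). ?\<Psi> c B)"
    for X :: "(((nat \<Rightarrow> nat \<Rightarrow> real^'n) \<times> (nat \<Rightarrow> nat \<Rightarrow> real^'n)) \<times> (real^'n^'n)) set"
    using continuous_on_family_defect by (simp add: case_prod_beta)
  have union: "subspace_union m (\<Union>(frame_family m r E))" if "E \<in> ?fr" for E
    unfolding subspace_union_def
    using that r frame_span_Gr by (intro exI[of _ "frame_family m r E"]) (auto simp: frame_family_def)
  have "\<exists>\<delta>>0. \<forall>c\<in>?fr \<times> ?fr. \<forall>\<mu>\<in>K. \<delta> \<le> (\<integral>A. ?\<Psi> c (sgn A) \<partial>\<mu>)"
  proof (rule compact_family_integral_gap[OF K C cont])
    fix c and \<mu> assume c: "c \<in> ?fr \<times> ?fr" and \<mu>: "\<mu> \<in> K"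
    obtain E E' where E: "c = (E, E')" "E \<in> ?fr" "E' \<in> ?fr" using c by auto
    show "\<not> (AE A in \<mu>. ?\<Psi> c (sgn A) = 0)"
    proof
      assume AE0: "AE A in \<mu>. ?\<Psi> c (sgn A) = 0"
      have zero: "(*v) A ` \<Union>(frame_family m r E') = \<Union>(frame_family m r E)"
        if "A \<in> space \<mu>" "?\<Psi> c (sgn A) = 0" for A
      proof -
        have "A \<in> SL" using that \<mu> KS SL_probsD(3) by auto
        then have "(`) ((*v) A) ` frame_family m r E' = frame_family m r E"
          using family_defect_eq_0_iff[of E m E' A r] E that(2) by auto
        then show ?thesis by (metis image_Union)
      qed
      have "AE A in \<mu>. ?\<Psi> c (sgn A) = 0 \<longrightarrow>
          (*v) A ` \<Union>(frame_family m r E') = \<Union>(frame_family m r E)"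
        by (rule AE_I2, rule impI, rule zero)
      from AE_mp[OF AE0 this]
      have "AE A in \<mu>. (*v) A ` \<Union>(frame_family m r E') = \<Union>(frame_family m r E)" .
      then show False using no_subspaces \<mu> union[OF E(2)] union[OF E(3)] by blast
    qed
  qed (auto simp: family_defect_nonneg)
  then obtain \<delta> where \<delta>: "\<delta> > 0"
    "\<And>E E' \<mu>. E \<in> ?fr \<Longrightarrow> E' \<in> ?fr \<Longrightarrow> \<mu> \<in> K \<Longrightarrow> \<delta> \<le> (\<integral>A. family_defect m r E E' (sgn A) \<partial>\<mu>)"
    by fastforce
  have comp: "compact ((?fr \<times> ?fr) \<times> sphere (0::real^'n^'n) 1)" by (intro compact_Times C compact_sphere)
  obtain M0 where M0: "\<And>E E' B. E \<in> ?fr \<Longrightarrow> E' \<in> ?fr \<Longrightarrow> B \<in> sphere 0 1 \<Longrightarrow> norm (family_defect m r E E' B) \<le> M0"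
    using compact_imp_bounded[OF compact_continuous_image[OF continuous_on_family_defect[of _ m r] comp]]
    by (fastforce simp: bounded_iff)
  define M where "M = max M0 1"
  have M: "family_defect m r E E' (sgn A) \<le> M" if "E \<in> ?fr" "E' \<in> ?fr" "A \<in> SL" for E E' A
    using M0[OF that(1,2), of "sgn A"] SL_mult_vec(2)[OF that(3)] by (auto simp: M_def norm_sgn)
  have "M > 0" by (simp add: M_def)
  show ?thesis
  proof (intro exI[of _ "\<delta> / M"] conjI ballI allI impI)
    show "\<delta> / M > 0" using \<delta> \<open>M > 0\<close> by simp
    fix \<mu> S S' H
    assume \<mu>: "\<mu> \<in> K" and *: "S \<subseteq> Gr m \<and> card S = r \<and> S' \<subseteq> Gr m \<and> card S' = r \<and>
      H \<in> sets \<mu> \<and> (\<forall>A\<in>H. (`) ((*v) A) ` S' = S)"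
    have \<mu>S: "\<mu> \<in> SL_probs" using \<mu> KS by auto
    interpret prob_space \<mu> by (rule SL_probsD(1)[OF \<mu>S])
    have H: "H \<in> sets \<mu>" using * by auto
    obtain E E' where E: "E \<in> ?fr" "frame_family m r E = S" "E' \<in> ?fr" "frame_family m r E' = S'"
      using frame_family_exists[of S m r] frame_family_exists[of S' m r] * r by auto
    have "\<delta> \<le> (\<integral>A. family_defect m r E E' (sgn A) \<partial>\<mu>)" by (rule \<delta>(2)[OF E(1,3) \<mu>])
    also have "\<dots> \<le> (\<integral>A. M * indicator (space \<mu> - H) A \<partial>\<mu>)"
    proof (rule integral_mono')
      show "integrable \<mu> (\<lambda>A. M * indicator (space \<mu> - H) A)"
        using H by (intro integrable_mult_right integrable_real_indicator) (auto simp: emeasure_eq_measure)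
      fix A assume A: "A \<in> space \<mu>"
      then have SLA: "A \<in> SL" using SL_probsD(3)[OF \<mu>S] by simp
      have "family_defect m r E E' (sgn A) = 0" if "A \<in> H"
        using family_defect_eq_0_iff[of E m E' A r] E SLA that * by auto
      then show "family_defect m r E E' (sgn A) \<le> M * indicator (space \<mu> - H) A"
        using M[OF E(1,3) SLA] A by (auto simp: indicator_def)
      show "0 \<le> M * indicator (space \<mu> - H) A" using \<open>M > 0\<close> by simp
    qed
    also have "\<dots> = M * (1 - measure \<mu> H)" using H by (simp add: prob_compl)
    finally show "measure \<mu> H \<le> 1 - \<delta> / M" using \<open>M > 0\<close> by (simp add: field_simps)
  qed
qed

section \<open>Dissolving the weight of subspaces\<close>

text \<open>
  The Bonferroni inequality, in the crude form with \<open>n\<^sup>2\<close> instead of \<open>n (n - 1) / 2\<close> pairs.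
\<close>

lemma measure_Union_ge:
  assumes "prob_space \<nu>" "finite S" "S \<subseteq> sets \<nu>"
    and "\<And>L. L \<in> S \<Longrightarrow> a \<le> measure \<nu> L"
    and "\<And>L M. L \<in> S \<Longrightarrow> M \<in> S \<Longrightarrow> L \<noteq> M \<Longrightarrow> measure \<nu> (L \<inter> M) \<le> \<delta>"
    and "\<delta> \<ge> 0"
  shows "real (card S) * a - (real (card S))\<^sup>2 * \<delta> \<le> measure \<nu> (\<Union>S)"
proof -
  interpret prob_space \<nu> by fact
  show ?thesis using assms(2-5)
  proof (induction S rule: finite_induct)
    case (insert L S)
    let ?n = "real (card S)"
    have sets: "L \<in> sets \<nu>" "\<Union>S \<in> sets \<nu>" using insert by (auto intro!: sets.finite_Union)
    have "L \<inter> \<Union>S = (\<Union>M\<in>S. L \<inter> M)" by auto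
    moreover have "measure \<nu> (\<Union>M\<in>S. L \<inter> M) \<le> (\<Sum>M\<in>S. measure \<nu> (L \<inter> M))"
      using insert by (intro finite_measure_subadditive_finite) auto
    ultimately have "measure \<nu> (L \<inter> \<Union>S) \<le> (\<Sum>M\<in>S. measure \<nu> (L \<inter> M))" by simp
    also have "\<dots> \<le> (\<Sum>M\<in>S. \<delta>)" using insert by (intro sum_mono) auto
    finally have 1: "measure \<nu> (L \<inter> \<Union>S) \<le> ?n * \<delta>" by simp
    have 2: "measure \<nu> (L \<union> \<Union>S) = measure \<nu> L + measure \<nu> (\<Union>S) - measure \<nu> (L \<inter> \<Union>S)"
      using finite_measure_Union'[OF sets] finite_measure_Diff'[OF sets(2,1)] by (simp add: Int_commute)
    have 3: "?n * a - ?n\<^sup>2 * \<delta> \<le> measure \<nu> (\<Union>S)" using insert by auto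
    have 4: "a \<le> measure \<nu> L" using insert by auto
    have "(?n + 1) * a - (?n + 1)\<^sup>2 * \<delta> \<le> a - ?n * \<delta> + (?n * a - ?n\<^sup>2 * \<delta>)"
      using \<open>\<delta> \<ge> 0\<close> by (simp add: power2_eq_square algebra_simps)
    with 1 2 3 4 have "(?n + 1) * a - (?n + 1)\<^sup>2 * \<delta> \<le> measure \<nu> (L \<union> \<Union>S)" by linarith
    moreover have "real (card (insert L S)) = ?n + 1" using insert(1,2) by simp
    ultimately show ?case by simp
  qed simp
qed

text \<open>
  Markov's inequality for the nonnegative function \<open>c + \<delta> - f\<close>, whose integral is at most \<open>2 \<delta>\<close>.
\<close>

lemma measure_far_below_max_le:
  fixes f :: "'a \<Rightarrow> real"
  assumes "prob_space \<mu>" "f \<in> borel_measurable \<mu>"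
    and "\<And>x. x \<in> space \<mu> \<Longrightarrow> 0 \<le> f x" "\<And>x. x \<in> space \<mu> \<Longrightarrow> f x \<le> c + \<delta>"
    and "c - \<delta> \<le> (\<integral>x. f x \<partial>\<mu>)" "\<delta> > 0" "\<delta>0 > 0"
  shows "measure \<mu> {x \<in> space \<mu>. f x < c - \<delta>0} \<le> 2 * \<delta> / \<delta>0"
proof -
  interpret prob_space \<mu> by fact
  let ?H = "{x \<in> space \<mu>. f x < c - \<delta>0}"
  have H: "?H \<in> sets \<mu>" using assms(2) by measurable
  have iH: "integrable \<mu> (\<lambda>x. indicator ?H x :: real)"
    using H by (intro integrable_real_indicator) (auto simp: emeasure_eq_measure)
  have "(\<integral>x. f x \<partial>\<mu>) \<le> (\<integral>x. (c + \<delta>) - (\<delta>0 + \<delta>) * indicator ?H x \<partial>\<mu>)"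
  proof (rule integral_mono)
    show "integrable \<mu> f" using assms by (intro integrable_const_bound[of _ "c + \<delta>"]) auto
    show "integrable \<mu> (\<lambda>x. (c + \<delta>) - (\<delta>0 + \<delta>) * indicator ?H x)" using iH by auto
  qed (use assms in \<open>auto simp: indicator_def\<close>)
  also have "\<dots> = (c + \<delta>) - (\<delta>0 + \<delta>) * measure \<mu> ?H"
    using iH H by (simp add: prob_space)
  finally have "(\<delta>0 + \<delta>) * measure \<mu> ?H \<le> 2 * \<delta>" using assms(5) by linarith
  moreover have "\<delta>0 * measure \<mu> ?H \<le> (\<delta>0 + \<delta>) * measure \<mu> ?H"
    using assms(6) by (intro mult_right_mono) simp_all
  ultimately have "\<delta>0 * measure \<mu> ?H \<le> 2 * \<delta>" by linarith
  then show ?thesis using assms(7) by (simp only: pos_le_divide_eq mult.commute)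
qed

lemma vimage_Gr:
  fixes L :: "(real^'n) set"
  assumes "L \<in> Gr m" "A \<in> SL"
  shows "(*v) A -` L \<in> Gr m" "(*v) A ` ((*v) A -` L) = L"
proof -
  have b: "bij ((*v) A)" by (rule SL_mult_vec(1)[OF assms(2)])
  show im: "(*v) A ` ((*v) A -` L) = L" using b by (simp add: bij_def surj_image_vimage_eq)
  have s: "subspace ((*v) A -` L)"
    using assms(1) linear_subspace_vimage[OF matrix_vector_mul_linear, of L A] by (simp add: Gr_def)
  have "dim ((*v) A ` ((*v) A -` L)) = dim ((*v) A -` L)"
    by (rule dim_image_eq[OF matrix_vector_mul_linear inj_on_subset[OF bij_is_inj[OF b] subset_UNIV]])
  then show "(*v) A -` L \<in> Gr m" using s assms(1) im by (simp add: Gr_def)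
qed

lemma Gr_sets_borel: "L \<in> Gr m \<Longrightarrow> L \<in> sets borel"
  by (auto simp: Gr_def closed_subspace)

text \<open>
  The inductive step in the dimension. The hypothesis on lower dimensions bounds the number of
  simultaneously heavy subspaces; the gap contradicts the fact that a maximal set of them is
  the image of another such set with probability close to \<open>1\<close>.
\<close>

lemma weight_dissolves_step:
  fixes K :: "(real^'n^'n) measure set"
  assumes K: "K \<subseteq> SL_probs"
    and gap: "\<And>r. r > 0 \<Longrightarrow> \<exists>\<eta>>0. \<forall>\<mu>\<in>K. \<forall>S S' H. S \<subseteq> Gr m \<and> card S = r \<and>
      S' \<subseteq> Gr m \<and> card S' = r \<and> H \<in> sets \<mu> \<and> (\<forall>A\<in>H. (`) ((*v) A) ` S' = S) \<longrightarrow>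
      measure \<mu> H \<le> 1 - \<eta>"
    and lower: "\<And>\<epsilon>. \<epsilon> > 0 \<Longrightarrow> \<forall>\<^sub>F k in sequentially. \<forall>\<nu>\<in>walk_laws K k.
      \<forall>V. subspace V \<and> dim V < m \<longrightarrow> measure \<nu> V < \<epsilon>"
    and "\<epsilon> > 0"
  shows "\<forall>\<^sub>F k in sequentially. \<forall>\<nu>\<in>walk_laws K k. \<forall>L\<in>Gr m. measure \<nu> L < \<epsilon>"
proof -
  \<comment> \<open>\<open>c\<close> is the upper limit of the maximal weight: eventually no weight exceeds \<open>c + \<delta>\<close>, while
    weights of at least \<open>c - \<delta>\<close> occur again and again.\<close>
  define G where "G = {t. 0 \<le> t \<and> (\<forall>\<^sub>F k in sequentially. \<forall>\<nu>\<in>walk_laws K k. \<forall>L\<in>Gr m. measure \<nu> L \<le> t)}"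
  define c where "c = Inf G"
  have "1 \<in> G"
    using prob_space.prob_le_1[OF walk_laws_props(1)[OF K]] by (simp add: G_def)
  have bdd: "bdd_below G" by (auto simp: G_def intro!: bdd_belowI[of _ 0])
  have "0 \<le> t" if "t \<in> G" for t using that by (simp add: G_def)
  then have c0: "c \<ge> 0" unfolding c_def using \<open>1 \<in> G\<close> by (intro cInf_greatest) auto
  have upper: "\<forall>\<^sub>F k in sequentially. \<forall>\<nu>\<in>walk_laws K k. \<forall>L\<in>Gr m. measure \<nu> L \<le> c + \<delta>" if "\<delta> > 0" for \<delta>
  proof -
    have "G \<noteq> {}" "Inf G < c + \<delta>" using \<open>1 \<in> G\<close> that by (auto simp: c_def)
    from cInf_lessD[OF this] obtain t where t: "t \<in> G" "t < c + \<delta>" by blast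
    then have "\<forall>\<^sub>F k in sequentially. \<forall>\<nu>\<in>walk_laws K k. \<forall>L\<in>Gr m. measure \<nu> L \<le> t" by (simp add: G_def)
    then show ?thesis by eventually_elim (use t in force)
  qed
  have heavy: "\<exists>\<^sub>F k in sequentially. \<exists>\<nu>\<in>walk_laws K k. \<exists>L\<in>Gr m. c - \<delta> \<le> measure \<nu> L"
    if "\<delta> > 0" "\<delta> \<le> c" for \<delta>
  proof (rule ccontr)
    assume "\<not> ?thesis"
    then have "\<forall>\<^sub>F k in sequentially. \<forall>\<nu>\<in>walk_laws K k. \<forall>L\<in>Gr m. measure \<nu> L \<le> c - \<delta>"
      unfolding not_frequently by (rule eventually_mono) force
    then have "c - \<delta> \<in> G" using that by (simp add: G_def)
    then have "c \<le> c - \<delta>" unfolding c_def using bdd by (rule cInf_lower)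
    then show False using that by simp
  qed
  have "c = 0"
  proof (rule ccontr)
    assume "c \<noteq> 0"
    then have cpos: "c > 0" using c0 by simp
    \<comment> \<open>The numbers of simultaneously almost maximal subspaces that persist for late laws.\<close>
    define R where "R = {r. \<forall>\<delta>>0. \<exists>\<^sub>F k in sequentially. \<exists>\<nu>\<in>walk_laws K k.
        \<exists>S. S \<subseteq> Gr m \<and> card S = r \<and> (\<forall>L\<in>S. c - \<delta> \<le> measure \<nu> L)}"
    have "1 \<in> R" unfolding R_def
    proof (intro CollectI allI impI)
      fix \<delta> :: real assume "\<delta> > 0"
      then have "\<exists>\<^sub>F k in sequentially. \<exists>\<nu>\<in>walk_laws K k. \<exists>L\<in>Gr m. c - min \<delta> c \<le> measure \<nu> L"
        using cpos by (intro heavy) auto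
      then show "\<exists>\<^sub>F k in sequentially. \<exists>\<nu>\<in>walk_laws K k.
          \<exists>S. S \<subseteq> Gr m \<and> card S = 1 \<and> (\<forall>L\<in>S. c - \<delta> \<le> measure \<nu> L)"
      proof (rule frequently_elim1)
        fix k assume "\<exists>\<nu>\<in>walk_laws K k. \<exists>L\<in>Gr m. c - min \<delta> c \<le> measure \<nu> L"
        then obtain \<nu> L where "\<nu> \<in> walk_laws K k" "L \<in> Gr m" "c - min \<delta> c \<le> measure \<nu> L" by auto
        then show "\<exists>\<nu>\<in>walk_laws K k. \<exists>S. S \<subseteq> Gr m \<and> card S = 1 \<and> (\<forall>L\<in>S. c - \<delta> \<le> measure \<nu> L)"
          by (intro bexI[of _ \<nu>] exI[of _ "{L}"]) auto
      qed
    qed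
    have Rbound: "real r * (c / 2) \<le> 1" if "r \<in> R" for r
    proof (rule ccontr)
      assume big: "\<not> ?thesis"
      then have "r > 0" by (cases r) auto
      define w where "w = real r * (c / 2)"
      have w: "w > 1" using big by (simp only: w_def not_le)
      \<comment> \<open>Chosen so that the overlaps cost at most half of the excess \<open>w - 1\<close> of the total weight.\<close>
      define \<delta> where "\<delta> = (w - 1) / (2 * (real r)\<^sup>2)"
      have "\<delta> > 0" using w \<open>r > 0\<close> by (simp add: \<delta>_def)
      have "\<exists>\<^sub>F k in sequentially. \<exists>\<nu>\<in>walk_laws K k.
          \<exists>S. S \<subseteq> Gr m \<and> card S = r \<and> (\<forall>L\<in>S. c - c / 2 \<le> measure \<nu> L)"
        using that half_gt_zero[OF cpos] unfolding R_def by blast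
      from frequently_ex[OF frequently_eventually_conj[OF this lower[OF \<open>\<delta> > 0\<close>]]]
      obtain k \<nu> S where k: "\<nu> \<in> walk_laws K k" "S \<subseteq> Gr m" "card S = r"
        and heavy_S: "\<And>L. L \<in> S \<Longrightarrow> c - c / 2 \<le> measure \<nu> L"
        and low: "\<And>V. subspace V \<Longrightarrow> dim V < m \<Longrightarrow> measure \<nu> V < \<delta>"
        by blast
      have "real (card S) * (c / 2) - (real (card S))\<^sup>2 * \<delta> \<le> measure \<nu> (\<Union>S)"
      proof (rule measure_Union_ge[OF walk_laws_props(1)[OF K k(1)]])
        show "finite S" using k(3) \<open>r > 0\<close> by (simp add: card_ge_0_finite)
        show "S \<subseteq> sets \<nu>" using k(2) walk_laws_props(2)[OF K k(1)] Gr_sets_borel by auto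
        fix L M assume LM: "L \<in> S" "M \<in> S" "L \<noteq> M"
        then have g: "subspace L" "subspace M" "dim L = m" "dim M = m" using k(2) by (auto simp: Gr_def)
        have "dim (L \<inter> M) < m"
        proof (rule ccontr)
          assume "\<not> ?thesis"
          then have "L \<inter> M = L"
            using g(3) by (intro subspace_dim_equal[OF subspace_inter[OF g(1,2)] g(1)]) simp_all
          moreover have "L \<inter> M = M"
            using g(4) \<open>\<not> dim (L \<inter> M) < m\<close>
            by (intro subspace_dim_equal[OF subspace_inter[OF g(1,2)] g(2)]) simp_all
          ultimately show False using LM(3) by blast
        qed
        then show "measure \<nu> (L \<inter> M) \<le> \<delta>" using low[OF subspace_inter[OF g(1,2)]] by simp
      next
        show "c / 2 \<le> measure \<nu> L" if "L \<in> S" for L using heavy_S[OF that] by simp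
        show "0 \<le> \<delta>" using \<open>\<delta> > 0\<close> by simp
      qed
      also have "\<dots> \<le> 1" by (rule prob_space.prob_le_1[OF walk_laws_props(1)[OF K k(1)]])
      finally have "w - (real r)\<^sup>2 * \<delta> \<le> 1" unfolding k(3) w_def .
      moreover have "(real r)\<^sup>2 * \<delta> = (w - 1) / 2"
        using \<open>r > 0\<close> by (simp add: \<delta>_def)
      ultimately have "w - (w - 1) / 2 \<le> 1" by (simp only:)
      then show False using w by (simp add: field_simps)
    qed
    have "R \<subseteq> {..nat \<lfloor>2 / c\<rfloor>}"
    proof
      fix r assume "r \<in> R"
      then have "real r \<le> 2 / c" using Rbound[of r] cpos by (simp add: field_simps)
      then show "r \<in> {..nat \<lfloor>2 / c\<rfloor>}" by (simp add: le_nat_floor)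
    qed
    then have finR: "finite R" by (rule finite_subset) simp
    define r where "r = Max R"
    have r: "r \<in> R" "r > 0" "Suc r \<notin> R"
    proof -
      have "R \<noteq> {}" using \<open>1 \<in> R\<close> by blast
      then show "r \<in> R" unfolding r_def by (rule Max_in[OF finR])
      have "1 \<le> r" unfolding r_def by (rule Max_ge[OF finR \<open>1 \<in> R\<close>])
      then show "r > 0" by simp
      show "Suc r \<notin> R"
      proof
        assume "Suc r \<in> R"
        then have "Suc r \<le> r" unfolding r_def by (rule Max_ge[OF finR])
        then show False by simp
      qed
    qed
    from r(3) obtain \<delta>0 where \<delta>0: "\<delta>0 > 0" and rare: "\<not> (\<exists>\<^sub>F k in sequentially.
        \<exists>\<nu>\<in>walk_laws K k.
          \<exists>S. S \<subseteq> Gr m \<and> card S = Suc r \<and> (\<forall>L\<in>S. c - \<delta>0 \<le> measure \<nu> L))"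
      unfolding R_def mem_Collect_eq not_all not_imp by (elim exE conjE)
    from rare have max: "\<forall>\<^sub>F k in sequentially. \<forall>\<nu>\<in>walk_laws K k.
        \<not> (\<exists>S. S \<subseteq> Gr m \<and> card S = Suc r \<and> (\<forall>L\<in>S. c - \<delta>0 \<le> measure \<nu> L))"
      unfolding not_frequently by (rule eventually_mono) blast
    from gap[OF r(2)] obtain \<eta>' where \<eta>': "\<eta>' > 0"
      "\<forall>\<mu>\<in>K. \<forall>S S' H. S \<subseteq> Gr m \<and> card S = r \<and> S' \<subseteq> Gr m \<and> card S' = r \<and>
        H \<in> sets \<mu> \<and> (\<forall>A\<in>H. (`) ((*v) A) ` S' = S) \<longrightarrow> measure \<mu> H \<le> 1 - \<eta>'"
      by (elim exE conjE)
    \<comment> \<open>The cap at \<open>1\<close> makes \<open>1 - \<eta> / 2\<close> positive, so that the event \<open>H\<close> below is nonempty.\<close>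
    define \<eta> where "\<eta> = min \<eta>' 1"
    have \<eta>: "0 < \<eta>" "\<eta> \<le> \<eta>'" "\<eta> \<le> 1" using \<eta>'(1) by (auto simp: \<eta>_def)
    \<comment> \<open>Each of the \<open>r\<close> subspaces loses probability at most \<open>2 \<delta> / \<delta>0\<close>, in total \<open>\<eta> / 2\<close>.\<close>
    define \<delta> where "\<delta> = \<eta> * \<delta>0 / (4 * real r)"
    have \<delta>: "\<delta> > 0" using \<eta> \<delta>0 r by (simp add: \<delta>_def)
    from eventually_conj[OF upper[OF \<delta>] max] obtain k0 where k0: "\<forall>k\<ge>k0.
        (\<forall>\<nu>\<in>walk_laws K k. \<forall>L\<in>Gr m. measure \<nu> L \<le> c + \<delta>) \<and> (\<forall>\<nu>\<in>walk_laws K k.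
        \<not> (\<exists>S. S \<subseteq> Gr m \<and> card S = Suc r \<and> (\<forall>L\<in>S. c - \<delta>0 \<le> measure \<nu> L)))"
      unfolding eventually_sequentially by (elim exE)
    have "\<exists>\<^sub>F k in sequentially. \<exists>\<nu>\<in>walk_laws K k.
        \<exists>S. S \<subseteq> Gr m \<and> card S = r \<and> (\<forall>L\<in>S. c - \<delta> \<le> measure \<nu> L)"
      using r(1) \<delta> unfolding R_def by blast
    from frequently_ex[OF frequently_eventually_conj[OF this eventually_ge_at_top[of "Suc k0"]]]
    obtain k1 \<nu>1 S where 1: "k1 \<ge> Suc k0" "\<nu>1 \<in> walk_laws K k1" "S \<subseteq> Gr m" "card S = r"
      "\<And>L. L \<in> S \<Longrightarrow> c - \<delta> \<le> measure \<nu>1 L"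
      by blast
    obtain k where k: "k1 = Suc k" "k \<ge> k0" using 1(1) by (cases k1) auto
    then obtain \<mu> \<nu> where \<mu>: "\<mu> \<in> K" and \<nu>: "\<nu> \<in> walk_laws K k" and push: "\<nu>1 = push \<mu> \<nu>"
      using 1(2) unfolding k(1) walk_laws.simps by blast
    have \<mu>S: "\<mu> \<in> SL_probs" using \<mu> K by blast
    interpret M: prob_space \<mu> by (rule SL_probsD(1)[OF \<mu>S])
    have finS: "finite S" using 1(4) r(2) by (simp add: card_ge_0_finite)
    note p = push_props[OF \<mu>S walk_laws_props(1,2)[OF K \<nu>] Gr_sets_borel]
    \<comment> \<open>The only candidates for the preimages of \<open>S\<close>; by maximality of \<open>r\<close> there are at most \<open>r\<close>, so
      \<open>r\<close> distinct preimages in \<open>S'\<close> exhaust it.\<close>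
    define S' where "S' = {L \<in> Gr m. c - \<delta>0 \<le> measure \<nu> L}"
    have noSuc: "card T \<noteq> Suc r" if "T \<subseteq> S'" for T
    proof
      assume "card T = Suc r"
      moreover have "T \<subseteq> Gr m" "\<forall>L\<in>T. c - \<delta>0 \<le> measure \<nu> L"
        using that unfolding S'_def by blast+
      ultimately show False using conjunct2[OF k0[rule_format, OF k(2)], rule_format, OF \<nu>] by blast
    qed
    have finS': "finite S'"
    proof (rule ccontr)
      assume "infinite S'"
      from infinite_arbitrarily_large[OF this, of "Suc r"] obtain T where "card T = Suc r" "T \<subseteq> S'"
        by (elim exE conjE)
      then show False using noSuc by simp
    qed
    have cardS': "card S' \<le> r"
    proof (rule ccontr)
      assume "\<not> card S' \<le> r"
      then have "Suc r \<le> card S'" by simp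
      from obtain_subset_with_card_n[OF this] obtain T where "T \<subseteq> S'" "card T = Suc r" .
      then show False using noSuc by simp
    qed
    define H where "H = {A \<in> space \<mu>. \<forall>L\<in>S. c - \<delta>0 \<le> measure \<nu> ((*v) A -` L)}"
    have compl: "space \<mu> - H = (\<Union>L\<in>S. {A \<in> space \<mu>. measure \<nu> ((*v) A -` L) < c - \<delta>0})"
      by (auto simp: H_def not_le)
    have bad: "{A \<in> space \<mu>. measure \<nu> ((*v) A -` L) < c - \<delta>0} \<in> sets \<mu>" if "L \<in> S" for L
      using that 1(3) by (intro borel_measurable_less p(3)[of L m] borel_measurable_const) blast
    have "measure \<mu> (space \<mu> - H) \<le> (\<Sum>L\<in>S. measure \<mu> {A \<in> space \<mu>. measure \<nu> ((*v) A -` L) < c - \<delta>0})"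
      unfolding compl using bad by (intro M.finite_measure_subadditive_finite finS) auto
    also have "\<dots> \<le> (\<Sum>L\<in>S. 2 * \<delta> / \<delta>0)"
    proof (rule sum_mono)
      fix L assume L: "L \<in> S"
      then have LG: "L \<in> Gr m" using 1(3) by auto
      show "measure \<mu> {A \<in> space \<mu>. measure \<nu> ((*v) A -` L) < c - \<delta>0} \<le> 2 * \<delta> / \<delta>0"
      proof (rule measure_far_below_max_le[OF M.prob_space_axioms p(3)[OF LG] _ _ _ \<delta> \<delta>0])
        show "measure \<nu> ((*v) A -` L) \<le> c + \<delta>" if "A \<in> space \<mu>" for A
          using that SL_probsD(3)[OF \<mu>S]
          by (intro conjunct1[OF k0[rule_format, OF k(2)], rule_format, OF \<nu>] vimage_Gr(1)[OF LG]) simp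
        show "c - \<delta> \<le> (\<integral>A. measure \<nu> ((*v) A -` L) \<partial>\<mu>)" using 1(5)[OF L] p(4)[OF LG] push by simp
      qed simp
    qed
    also have "\<dots> = \<eta> / 2" using 1(4) r(2) \<delta>0 by (simp add: \<delta>_def)
    finally have comp: "measure \<mu> (space \<mu> - H) \<le> \<eta> / 2" .
    have "space \<mu> - H \<in> sets \<mu>" unfolding compl using bad finS by auto
    then have "space \<mu> - (space \<mu> - H) \<in> sets \<mu>" by auto
    moreover have "space \<mu> - (space \<mu> - H) = H" by (auto simp: H_def)
    ultimately have Hs: "H \<in> sets \<mu>" by simp
    have HP: "measure \<mu> H \<ge> 1 - \<eta> / 2" using comp M.prob_compl[OF Hs] by simp
    have good: "(\<lambda>L. (*v) A -` L) ` S = S'" "card S' = r" "(`) ((*v) A) ` S' = S" if "A \<in> H" for A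
    proof -
      have A: "A \<in> SL" using that SL_probsD(3)[OF \<mu>S] by (auto simp: H_def)
      have im: "(*v) A ` ((*v) A -` L) = L" if "L \<in> S" for L using vimage_Gr(2)[OF _ A] that 1(3) by auto
      have sub: "(\<lambda>L. (*v) A -` L) ` S \<subseteq> S'"
        using that vimage_Gr(1)[OF _ A] 1(3) by (auto simp: S'_def H_def)
      have "inj_on (\<lambda>L. (*v) A -` L) S" by (rule inj_on_inverseI[of S "(`) ((*v) A)"]) (rule im)
      then have card: "card ((\<lambda>L. (*v) A -` L) ` S) = r" using 1(4) by (simp add: card_image)
      show eq: "(\<lambda>L. (*v) A -` L) ` S = S'"
        using card cardS' by (intro card_seteq[OF finS' sub]) simp
      show "card S' = r" using card eq by simp
      have "(\<lambda>L. (*v) A ` ((*v) A -` L)) ` S = (\<lambda>L. L) ` S"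
        by (rule image_cong[OF refl im])
      then show "(`) ((*v) A) ` S' = S" unfolding eq[symmetric] image_image image_ident .
    qed
    have "H \<noteq> {}" using HP \<eta> by auto
    then have "card S' = r" using good(2) by blast
    moreover have "S' \<subseteq> Gr m" by (auto simp: S'_def)
    ultimately have "measure \<mu> H \<le> 1 - \<eta>'"
      using 1(3,4) Hs good(3) by (intro \<eta>'(2)[rule_format, OF \<mu>, of S S']) blast
    then show False using HP \<eta> by simp
  qed
  have "\<forall>\<^sub>F k in sequentially. \<forall>\<nu>\<in>walk_laws K k. \<forall>L\<in>Gr m. measure \<nu> L \<le> \<epsilon> / 2"
    using upper[of "\<epsilon> / 2"] \<open>\<epsilon> > 0\<close> \<open>c = 0\<close> by simp
  then show ?thesis
  proof (rule eventually_mono, intro ballI)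
    fix k \<nu> and L :: "(real^'n) set"
    assume "\<forall>\<nu>\<in>walk_laws K k. \<forall>L\<in>Gr m. measure \<nu> L \<le> \<epsilon> / 2" "\<nu> \<in> walk_laws K k" "L \<in> Gr m"
    then have "measure \<nu> L \<le> \<epsilon> / 2" by blast
    then show "measure \<nu> L < \<epsilon>" using \<open>\<epsilon> > 0\<close> by simp
  qed
qed

text \<open>
  In dimension \<open>0\<close> the claim holds because matrices of determinant \<open>1\<close> never send a nonzero vector
  to \<open>0\<close>; the step to dimension \<open>j\<close> uses the hypothesis on unions of \<open>j\<close>-dimensional subspaces.
\<close>

lemma weight_dissolves:
  fixes K :: "(real^'n^'n) measure set"
  assumes K: "compactin SL_weak_topology K"
    and no_subspaces: "\<And>j. j \<in> {1..m} \<Longrightarrow>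
      \<not> (\<exists>\<mu>\<in>K. \<exists>U U'. subspace_union j U \<and> subspace_union j U' \<and>
            (AE A in \<mu>. (*v) A ` U = U'))"
    and "\<epsilon> > 0"
  shows "\<forall>\<^sub>F k in sequentially. \<forall>\<nu>\<in>walk_laws K k.
    \<forall>V. subspace V \<and> dim V \<le> m \<longrightarrow> measure \<nu> V < \<epsilon>"
  using assms(2,3)
proof (induction m arbitrary: \<epsilon>)
  have KS: "K \<subseteq> SL_probs" using compactin_subset_topspace[OF K] by (simp add: topspace_SL_weak_topology)
  {
    case 0
    have "V = {0}" if "subspace V" "dim V = 0" for V :: "(real^'n) set"
      using that subspace_0 by (auto simp: dim_eq_0)
    then have "measure \<nu> V < \<epsilon>" if "\<nu> \<in> walk_laws K k" "subspace V" "dim V \<le> 0"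
      for k \<nu> and V :: "(real^'n) set"
      using walk_laws_props(3)[OF KS that(1)] that(2,3) 0(2) by (metis le_zero_eq)
    then show ?case by (intro always_eventually) blast
  next
    case (Suc m)
    have low: "\<forall>\<^sub>F k in sequentially. \<forall>\<nu>\<in>walk_laws K k.
        \<forall>V. subspace V \<and> dim V \<le> m \<longrightarrow> measure \<nu> V < \<epsilon>" if "\<epsilon> > 0" for \<epsilon>
      using that by (intro Suc.IH Suc.prems(1)) simp_all
    have "\<forall>\<^sub>F k in sequentially. \<forall>\<nu>\<in>walk_laws K k. \<forall>L\<in>Gr (Suc m). measure \<nu> L < \<epsilon>"
    proof (rule weight_dissolves_step[OF KS])
      show "\<exists>\<eta>>0. \<forall>\<mu>\<in>K. \<forall>S S' H. S \<subseteq> Gr (Suc m) \<and> card S = r \<and>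
          S' \<subseteq> Gr (Suc m) \<and> card S' = r \<and> H \<in> sets \<mu> \<and> (\<forall>A\<in>H. (`) ((*v) A) ` S' = S) \<longrightarrow>
          measure \<mu> H \<le> 1 - \<eta>" if "r > 0" for r
        using that Suc.prems(1)[of "Suc m"] by (intro subspace_family_gap[OF K]) auto
    qed (use low Suc.prems in \<open>auto simp: less_Suc_eq_le\<close>)
    with low[OF Suc.prems(2)] show ?case
      by eventually_elim (auto simp: Gr_def le_Suc_eq)
  }
qed

theorem proposition1p15:
  fixes K :: "(real^'n^'n) measure set" and m :: nat
  assumes d_ge_2: "CARD('n) \<ge> 2"
    and compact_K: "compactin SL_weak_topology K"
    and log_moment: "\<And>\<mu>. \<mu> \<in> K \<Longrightarrow> (\<integral>\<^sup>+A. ennreal (ln (onorm ((*v) A))) \<partial>\<mu>) < \<infinity>"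
    and no_measures: "\<And>\<mu>. \<mu> \<in> K \<Longrightarrow>
      \<not> (\<exists>\<nu>1\<in>proj_probs. \<exists>\<nu>2\<in>proj_probs. AE A in \<mu>. distr \<nu>1 proj_borel (proj_map A) = \<nu>2)"
    and m_bounds: "1 \<le> m" "m \<le> CARD('n) - 1"
    and no_subspaces: "\<And>j. j \<in> {1..m} \<Longrightarrow>
      \<not> (\<exists>\<mu>\<in>K. \<exists>U U'. subspace_union j U \<and> subspace_union j U' \<and>
            (AE A in \<mu>. (*v) A ` U = U'))"
  shows "\<forall>\<epsilon>>0. \<exists>k\<^sub>m. \<forall>k\<ge>k\<^sub>m. \<forall>x\<^sub>0\<in>proj_space. \<forall>L\<in>Gr m. \<forall>\<mu>.
    (\<forall>i\<in>{1..k}. \<mu> i \<in> K) \<longrightarrow>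
    measure (PiM {1..k} \<mu>)
      {A \<in> space (PiM {1..k} \<mu>). proj_walk A k x\<^sub>0 \<in> proj_subspace L} < \<epsilon>"
proof (intro allI impI)
  fix \<epsilon> :: real assume "\<epsilon> > 0"
  have KS: "K \<subseteq> SL_probs"
    using compactin_subset_topspace[OF compact_K] by (simp add: topspace_SL_weak_topology)
  obtain k\<^sub>m where k\<^sub>m: "\<And>k \<nu> V. k \<ge> k\<^sub>m \<Longrightarrow> \<nu> \<in> walk_laws K k \<Longrightarrow> subspace V \<Longrightarrow> dim V \<le> m \<Longrightarrow>
      measure \<nu> V < \<epsilon>"
    using weight_dissolves[OF compact_K no_subspaces \<open>\<epsilon> > 0\<close>, where m = m]
    unfolding eventually_sequentially by blast
  show "\<exists>k\<^sub>m. \<forall>k\<ge>k\<^sub>m. \<forall>x\<^sub>0\<in>proj_space. \<forall>L\<in>Gr m. \<forall>\<mu>. (\<forall>i\<in>{1..k}. \<mu> i \<in> K) \<longrightarrow>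
    measure (PiM {1..k} \<mu>)
      {A \<in> space (PiM {1..k} \<mu>). proj_walk A k x\<^sub>0 \<in> proj_subspace L} < \<epsilon>"
  proof (intro exI[of _ k\<^sub>m] allI impI ballI)
    fix k \<mu> and x\<^sub>0 L :: "(real^'n) set"
    assume k: "k \<ge> k\<^sub>m" and x: "x\<^sub>0 \<in> proj_space" and L: "L \<in> Gr m" and \<mu>: "\<forall>i\<in>{1..k}. \<mu> i \<in> K"
    obtain v where v: "v \<noteq> 0" "x\<^sub>0 = span {v}" using x by (auto simp: proj_space_def)
    have sL: "subspace L" "dim L \<le> m" using L by (auto simp: Gr_def)
    obtain \<nu> where "\<nu> \<in> walk_laws K k" "measure (PiM {1..k} \<mu>)
      {A \<in> space (PiM {1..k} \<mu>). proj_walk A k x\<^sub>0 \<in> proj_subspace L} \<le> measure \<nu> L"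
      using measure_proj_walk_le[OF KS _ v(1) sL(1), of k \<mu>] \<mu> v(2) by auto
    then show "measure (PiM {1..k} \<mu>)
      {A \<in> space (PiM {1..k} \<mu>). proj_walk A k x\<^sub>0 \<in> proj_subspace L} < \<epsilon>"
      using k\<^sub>m[OF k _ sL] by (meson le_less_trans)
  qed
qed

end
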